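(* Let $0<p<1$. Then the largest constant $c_p$ such that for every integer $n\ge 1$ and all real numbers $a_1,\dots,a_n$, $$c_p\left(\sum_{j=1}^n a_j^2\right)^{1/2}\le \left\|\sum_{j=1}^n a_jU_j\right\|_p,$$ is $c_p=\|Z\|_p/\sqrt{3}$.
   Context: $U_1,U_2,\dots$ are independent random variables, each uniformly distributed on $[-1,1]$. $Z$ is a standard $N(0,1)$ Gaussian random variable. For a random variable $X$ and $p>0$, $\|X\|_p=(\mathbb{E}|X|^p)^{1/p}$ (also for $p<1$). Equivalently, $c_p=\inf\left\|\sum_{j=1}^n a_jU_j\right\|_p$, the infimum being over all $n\ge1$ and all unit vectors $(a_1,\dots,a_n)\in\mathbb{R}^n$ (Euclidean norm). *)

theory Defs
  imports "HOL-Probability.Probability"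
begin

(* Only used below for random variables with finite p-th moment; the Bochner integral of a
   non-integrable function would be 0.  The base of the outer powr is nonnegative, and
   0 powr r = 0, so p-th powers of a vanishing variable are treated correctly for p > 0. *)
definition pnorm :: "'a measure \<Rightarrow> real \<Rightarrow> ('a \<Rightarrow> real) \<Rightarrow> real" where
  "pnorm M p X = (\<integral>\<omega>. \<bar>X \<omega>\<bar> powr p \<partial>M) powr (1 / p)"

end

theory Submission
  imports Defs "HOL-Real_Asymp.Real_Asymp"
begin

text \<open>
  Write \<open>G = Z / sqrt 3\<close> and normalise \<open>\<Sum> a\<^sub>j\<^sup>2 = 1\<close>; the claim is \<open>E \<bar>\<Sum> a\<^sub>j U\<^sub>j\<bar>\<^sup>p \<ge> E \<bar>G\<bar>\<^sup>p\<close>.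
  Up to a constant, \<open>E \<bar>X\<bar>\<^sup>p\<close> is the integral of \<open>(1 - E cos (t X)) t\<^sup>-\<^sup>p\<^sup>-\<^sup>1\<close> over \<open>t > 0\<close>, and \<open>E cos (t X)\<close>
  is a product of sinc functions. Sharpness follows by dominated convergence for equal coefficients.

  If all \<open>a\<^sub>j\<^sup>2 \<le> 25/43\<close>, weighted AM-GM with weights \<open>a\<^sub>j\<^sup>2\<close> (as in Haagerup's proof of the Khinchin inequality)
  reduces the claim to comparing the integrals of \<open>(1 - \<bar>sinc t\<bar>\<^sup>s) t\<^sup>-\<^sup>p\<^sup>-\<^sup>1\<close> and
  \<open>(1 - exp (- s t\<^sup>2 / 6)) t\<^sup>-\<^sup>p\<^sup>-\<^sup>1\<close> for \<open>s \<ge> 43/25\<close>. The first integrand is the larger one up to \<open>\<pi>\<close>,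
  so, \<open>t\<^sup>-\<^sup>p\<close> being decreasing, it suffices to compare the gain before \<open>\<pi>\<close> with the loss after \<open>\<pi>\<close> for
  \<open>p = 0\<close>, where both are estimated explicitly.

  If some \<open>a\<^sub>i\<^sup>2 \<ge> 25/43\<close>, condition on the sum \<open>Y\<close> of the other terms. Then \<open>E \<bar>a\<^sub>i U\<^sub>i + y\<bar>\<^sup>p\<close> has a quartic
  minorant in \<open>y\<close>, only \<open>E Y\<^sup>2\<close> and \<open>E Y\<^sup>4 \<le> 3 (E Y\<^sup>2)\<^sup>2\<close> enter, and the result is compared with a sharp bound
  for \<open>E \<bar>Z\<bar>\<^sup>p\<close>.
\<close>


subsection \<open>Bounds for the sinc function\<close>

text \<open>In the weighted AM-GM step a coefficient a_j receives the exponent s = 1 / a_j^2, and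
  only |sinc| enters. The loss after pi is then estimated, for s <= 2, by (2 pi^2)^(-s/2) / s. This
  estimate grows as s decreases, so small exponents are left to the conditioning argument. That
  argument degrades in the opposite direction: its quartic minorant is exact to second order at 0,
  so it is good when the variance of Y is small compared with a_i^2, and its hardest exponent is the
  largest one. The value 43/25 is a cut at which both numerical estimates still close.

  At p = 0 each of the two compared integrals diverges at infinity, but the gain and the loss stay
  finite. For p > 0 the factor t^(-p) is at least pi^(-p) on the gain and at most pi^(-p) on the
  loss, so a single numerical estimate serves every p.\<close>

lemma powr_le_tangent_one:
  fixes u r :: real
  assumes "0 \<le> u" "0 \<le> r" "r \<le> 1"
  shows "u powr r \<le> 1 + r * (u - 1)"
proof (cases "u = 0")
  case True
  then show ?thesis using assms by simp
next
  case False
  then have "u powr r * 1 powr (1 - r) \<le> r * u + (1 - r) * 1"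
    using assms by (intro Youngs_inequality_0) auto
  then show ?thesis by (simp add: algebra_simps)
qed

text \<open>For these \<open>s\<close> the power is convex in \<open>y\<close>, so its tangent at 0
  lies on the wrong side. Splitting off one factor leaves the exponent \<open>s - 1\<close> in
  [0,1], where the tangent bound applies; the resulting quadratic is exact at \<open>y = 0\<close>
  and \<open>y = 1\<close>.\<close>

lemma one_minus_powr_le:
  fixes y s :: real
  assumes "0 \<le> y" "y \<le> 1" "1 \<le> s" "s \<le> 2"
  shows "(1 - y) powr s \<le> 1 - (s * y - (s - 1) * y\<^sup>2)"
proof -
  have "(1 - y) powr s = (1 - y) * (1 - y) powr (s - 1)"
    using assms by (cases "y = 1") (auto simp: powr_mult_base)
  also have "\<dots> \<le> (1 - y) * (1 + (s - 1) * ((1 - y) - 1))"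
    using assms by (intro mult_left_mono powr_le_tangent_one) auto
  also have "\<dots> = 1 - (s * y - (s - 1) * y\<^sup>2)"
    by (simp add: algebra_simps power2_eq_square)
  finally show ?thesis .
qed

text \<open>The series is 1 - sum over k >= 2 of (k - 1) w^k / k!, so for w >= 0 all corrections
  have the same sign and the terms of degree 2 and 3 may be kept alone.\<close>

lemma one_minus_mult_exp_le:
  fixes w :: real
  assumes "0 \<le> w"
  shows "(1 - w) * exp w \<le> 1 - (w\<^sup>2 / 2 + w ^ 3 / 3)"
proof -
  define f where "f = (\<lambda>w::real. 1 - (w\<^sup>2 / 2 + w ^ 3 / 3) - (1 - w) * exp w)"
  have "f 0 \<le> f w"
  proof (rule DERIV_nonneg_imp_nondecreasing[OF assms])
    fix x :: real assume x: "0 \<le> x" "x \<le> w"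
    have "(f has_real_derivative x * (exp x - (1 + x))) (at x)"
      unfolding f_def by (auto intro!: derivative_eq_intros simp: algebra_simps power2_eq_square)
    moreover have "0 \<le> x * (exp x - (1 + x))"
      using x by (intro mult_nonneg_nonneg) auto
    ultimately show "\<exists>y. (f has_real_derivative y) (at x) \<and> 0 \<le> y" by blast
  qed
  then show ?thesis by (simp add: f_def)
qed

text \<open>In Euler's product for the sine the factor k = 1 is kept exactly and the others are
  bounded by 1 - u <= exp (-u). By the Basel sum the exponents over all k add up to t^2/6; the
  factor exp (t^2/pi^2) takes back the share of k = 1. The exact first factor provides the gain over
  the Gaussian.\<close>

lemma sinc_le:
  fixes t :: real
  assumes "0 < t" "t \<le> pi"
  shows "sin t / t \<le> (1 - t\<^sup>2 / pi\<^sup>2) * exp (t\<^sup>2 / pi\<^sup>2) * exp (- t\<^sup>2 / 6)"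
proof -
  define x where "x = t / pi"
  have x: "0 < x" "x \<le> 1" "pi * x = t" "t\<^sup>2 / pi\<^sup>2 = x\<^sup>2"
    using assms by (auto simp: x_def power_divide)
  have x2: "x\<^sup>2 \<le> 1" using x by (simp add: power_le_one)
  define S where "S = (\<lambda>n. \<Sum>i<n. 1 / (real i + 1)\<^sup>2)"
  have S: "S \<longlonglongrightarrow> pi\<^sup>2 / 6"
    using inverse_squares_sums unfolding sums_def S_def by (simp add: add.commute)
  have prod_le: "(\<Prod>k=1..n. 1 - x\<^sup>2 / (real k)\<^sup>2) \<le> (1 - x\<^sup>2) * exp (x\<^sup>2) * exp (- x\<^sup>2 * S n) \<and>
      0 \<le> (\<Prod>k=1..n. 1 - x\<^sup>2 / (real k)\<^sup>2)" if "n \<ge> 1" for n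
    using that
  proof (induction n rule: nat_induct_at_least)
    case base
    show ?case using x2 by (simp add: S_def exp_add[symmetric] mult.assoc)
  next
    case (Suc n)
    let ?q = "x\<^sup>2 / (real (Suc n))\<^sup>2"
    have "?q \<le> 1"
      using x2 by (auto simp: field_simps) (smt (verit) one_le_power of_nat_0_le_iff)
    have eq: "(\<Prod>k=1..Suc n. 1 - x\<^sup>2 / (real k)\<^sup>2) = (\<Prod>k=1..n. 1 - x\<^sup>2 / (real k)\<^sup>2) * (1 - ?q)"
      by simp
    also have "\<dots> \<le> (1 - x\<^sup>2) * exp (x\<^sup>2) * exp (- x\<^sup>2 * S n) * exp (- ?q)"
      using Suc.IH \<open>?q \<le> 1\<close> exp_ge_add_one_self[of "- ?q"] x2
      by (intro mult_mono) auto
    also have "\<dots> = (1 - x\<^sup>2) * exp (x\<^sup>2) * exp (- x\<^sup>2 * S (Suc n))"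
    proof -
      have "- x\<^sup>2 * S (Suc n) = - x\<^sup>2 * S n + - ?q" by (simp add: S_def algebra_simps)
      then show ?thesis by (simp only: exp_add mult.assoc)
    qed
    finally have "(\<Prod>k=1..Suc n. 1 - x\<^sup>2 / (real k)\<^sup>2) \<le> (1 - x\<^sup>2) * exp (x\<^sup>2) * exp (- x\<^sup>2 * S (Suc n))" .
    moreover have "0 \<le> (\<Prod>k=1..Suc n. 1 - x\<^sup>2 / (real k)\<^sup>2)"
      unfolding eq using Suc.IH \<open>?q \<le> 1\<close> by (intro mult_nonneg_nonneg) auto
    ultimately show ?case by blast
  qed
  have "(\<lambda>n. \<Prod>k=1..n. 1 - x\<^sup>2 / (real k)\<^sup>2) \<longlonglongrightarrow> sin t / t"
    using sin_product_formula_real'[of x] x by simp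
  moreover have "(\<lambda>n. (1 - x\<^sup>2) * exp (x\<^sup>2) * exp (- x\<^sup>2 * S n)) \<longlonglongrightarrow> (1 - x\<^sup>2) * exp (x\<^sup>2) * exp (- x\<^sup>2 * (pi\<^sup>2 / 6))"
    by (intro tendsto_intros S)
  ultimately have "sin t / t \<le> (1 - x\<^sup>2) * exp (x\<^sup>2) * exp (- x\<^sup>2 * (pi\<^sup>2 / 6))"
    using prod_le by (intro LIMSEQ_le) blast+
  also have "- x\<^sup>2 * (pi\<^sup>2 / 6) = - t\<^sup>2 / 6" by (simp add: x_def power_divide)
  finally show ?thesis unfolding x(4) .
qed

lemma sinc_nonneg: "0 < t \<Longrightarrow> t \<le> pi \<Longrightarrow> 0 \<le> sin t / t"
  by (simp add: sin_ge_zero)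

lemma sinc_le_one: "\<bar>sin t / t\<bar> \<le> (1::real)"
  using abs_sin_x_le_abs_x[of t] by (auto simp: divide_simps abs_divide)

lemma pi_squared_bounds: "9.8696 \<le> pi\<^sup>2" "pi\<^sup>2 \<le> 9.87"
proof -
  have "3.1415926\<^sup>2 \<le> pi\<^sup>2" "pi\<^sup>2 \<le> 3.1416\<^sup>2"
    using pi_approx by (auto intro!: power_mono)
  then show "9.8696 \<le> pi\<^sup>2" "pi\<^sup>2 \<le> 9.87" by (auto simp: power2_eq_square)
qed

text \<open>The constant \<open>0.6079\<close> is a rational lower bound for \<open>6 / pi\<^sup>2\<close>.\<close>

lemma sinc_powr_le:
  fixes t s :: real
  assumes t: "0 < t" "t \<le> pi" and s: "0 < s"
  defines "y \<equiv> (0.6079 * (t\<^sup>2 / 6))\<^sup>2 / 2 + (0.6079 * (t\<^sup>2 / 6)) ^ 3 / 3"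
  shows "(sin t / t) powr s \<le> (1 - y) powr s * exp (- s * t\<^sup>2 / 6)" "0 \<le> y" "y \<le> 1"
proof -
  define W where "W = t\<^sup>2 / pi\<^sup>2"
  define w where "w = 0.6079 * (t\<^sup>2 / 6)"
  have yw: "y = w\<^sup>2 / 2 + w ^ 3 / 3" by (simp add: y_def w_def)
  have W: "0 \<le> W" "W \<le> 1" using t by (auto simp: W_def divide_le_eq intro: power_mono)
  have "pi\<^sup>2 * 0.6079 \<le> 6" using pi_squared_bounds by simp
  then have "t\<^sup>2 * (pi\<^sup>2 * 0.6079) \<le> t\<^sup>2 * 6" by (intro mult_left_mono) auto
  then have w: "0 \<le> w" "w \<le> W" by (auto simp: field_simps W_def w_def)
  \<comment> \<open>The bound holds at the true argument \<open>W\<close>; since the polynomial is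
    increasing it passes to the rational multiple \<open>w\<close> of
    \<open>t\<^sup>2\<close>.\<close>
  have mono: "w\<^sup>2 \<le> W\<^sup>2" "w ^ 3 \<le> W ^ 3" using w by (auto intro!: power_mono)
  have le1: "W\<^sup>2 \<le> 1" "W ^ 3 \<le> 1" using W by (auto intro!: power_le_one)
  show "0 \<le> y" "y \<le> 1" unfolding yw using mono le1 w(1) by auto
  have "sin t / t \<le> (1 - W) * exp W * exp (- t\<^sup>2 / 6)" using sinc_le[OF t] by (simp add: W_def)
  also have "\<dots> \<le> (1 - y) * exp (- t\<^sup>2 / 6)"
    using one_minus_mult_exp_le[OF W(1)] mono by (intro mult_right_mono) (auto simp: yw)
  finally have "(sin t / t) powr s \<le> ((1 - y) * exp (- t\<^sup>2 / 6)) powr s"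
    using sinc_nonneg[OF t] s by (intro powr_mono2) auto
  also have "\<dots> = (1 - y) powr s * exp (- s * t\<^sup>2 / 6)"
    using \<open>y \<le> 1\<close> exp_powr_real[of "- t\<^sup>2 / 6" s] by (simp add: powr_mult mult.commute)
  finally show "(sin t / t) powr s \<le> (1 - y) powr s * exp (- s * t\<^sup>2 / 6)" .
qed

lemma sinc_powr_gap_nonneg:
  fixes t s :: real
  assumes "0 < t" "t \<le> pi" "0 < s"
  shows "\<bar>sin t / t\<bar> powr s \<le> exp (- s * t\<^sup>2 / 6)"
proof -
  note b = sinc_powr_le[OF assms]
  have "(1 - ((0.6079 * (t\<^sup>2 / 6))\<^sup>2 / 2 + (0.6079 * (t\<^sup>2 / 6)) ^ 3 / 3)) powr s * exp (- s * t\<^sup>2 / 6)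
      \<le> 1 * exp (- s * t\<^sup>2 / 6)"
    using b(2,3) assms by (intro mult_right_mono powr_le1; simp only: exp_ge_zero; linarith)
  with b(1) have "(sin t / t) powr s \<le> exp (- s * t\<^sup>2 / 6)" by linarith
  with sinc_nonneg[OF assms(1,2)] show ?thesis by (simp only: abs_of_nonneg)
qed

text \<open>The decimals in the next two lemmas are roundings of the coefficients of \<open>s\<^sup>2 y - s (s - 1) y\<^sup>2\<close> and
  \<open>s q - s q\<^sup>2 / 2\<close> as polynomials in \<open>z\<close>, with the dependence on \<open>s\<close> replaced by its worst case.\<close>

lemma sinc_powr_gap_small:
  fixes t s :: real
  assumes t: "0 < t" "t \<le> pi" and s: "43/25 \<le> s" "s \<le> 2"
  defines "z \<equiv> s * t\<^sup>2 / 6"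
  shows "2 * z * exp (- z) * (0.09238 * z + 0.01872 * z\<^sup>2 - 0.00242 * z ^ 3 - 0.00114 * z ^ 4 - 0.000135 * z ^ 5)
    \<le> s * (exp (- z) - \<bar>sin t / t\<bar> powr s)"
proof -
  define w where "w = 0.6079 * (t\<^sup>2 / 6)"
  define y where "y = w\<^sup>2 / 2 + w ^ 3 / 3"
  have s0: "0 < s" using s by simp
  note b = sinc_powr_le[OF t s0, folded w_def, folded y_def]
  have z0: "0 \<le> z" using s0 by (simp add: z_def)
  have wz: "w = 0.6079 * z / s" using s0 by (simp add: z_def w_def)
  \<comment> \<open>On this range (s - 1) / s^n is decreasing for n = 3, 4, 5, so the decimals are
    its values at 43/25, rounded up; 1 / s is smallest at 2. Bernoulli's inequality supplies the
    tangent of s^n at 43/25 as a lower bound.\<close>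
  have s3: "(s - 1) / s ^ 3 \<le> 0.1416" "(s - 1) / s ^ 4 \<le> 0.0823" "(s - 1) / s ^ 5 \<le> 0.0479" "1/2 \<le> 1 / s"
  proof -
    have p: "(43/25) ^ n * (1 + real n * (25 * s / 43 - 1)) \<le> s ^ n" for n
      using Bernoulli_inequality[of "25 * s / 43 - 1" n] s by (simp add: power_mult_distrib power_divide field_simps)
    show "(s - 1) / s ^ 3 \<le> 0.1416" "(s - 1) / s ^ 4 \<le> 0.0823" "(s - 1) / s ^ 5 \<le> 0.0479" "1/2 \<le> 1 / s"
      using p[of 3] p[of 4] p[of 5] s by (auto simp: divide_le_eq field_simps)
  qed
  have y2: "y\<^sup>2 = w ^ 4 / 4 + w ^ 5 / 3 + w ^ 6 / 9"
    by (simp add: y_def power2_eq_square numeral_eq_Suc algebra_simps)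
  have "s * (s * y - (s - 1) * y\<^sup>2) = s\<^sup>2 * w\<^sup>2 / 2 + (s ^ 3 * w ^ 3 / 3) * (1 / s)
      - (s ^ 4 * w ^ 4 / 4 * ((s - 1) / s ^ 3) + s ^ 5 * w ^ 5 / 3 * ((s - 1) / s ^ 4)
      + s ^ 6 * w ^ 6 / 9 * ((s - 1) / s ^ 5))"
    unfolding y2 unfolding y_def using s0 by (simp add: field_simps numeral_eq_Suc)
  also have "\<dots> = (0.6079 * z)\<^sup>2 / 2 + ((0.6079 * z) ^ 3 / 3) * (1 / s)
      - ((0.6079 * z) ^ 4 / 4 * ((s - 1) / s ^ 3) + (0.6079 * z) ^ 5 / 3 * ((s - 1) / s ^ 4)
      + (0.6079 * z) ^ 6 / 9 * ((s - 1) / s ^ 5))"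
    unfolding power_mult_distrib[symmetric] wz using s0 by simp
  also have "\<dots> \<ge> (0.6079 * z)\<^sup>2 / 2 + ((0.6079 * z) ^ 3 / 3) * (1 / 2)
      - ((0.6079 * z) ^ 4 / 4 * 0.1416 + (0.6079 * z) ^ 5 / 3 * 0.0823 + (0.6079 * z) ^ 6 / 9 * 0.0479)"
    using z0 by (intro diff_mono add_mono mult_left_mono s3) auto
  moreover have "(0.6079 * z)\<^sup>2 / 2 + ((0.6079 * z) ^ 3 / 3) * (1 / 2)
      - ((0.6079 * z) ^ 4 / 4 * 0.1416 + (0.6079 * z) ^ 5 / 3 * 0.0823 + (0.6079 * z) ^ 6 / 9 * 0.0479)
      \<ge> 2 * z * (0.09238 * z + 0.01872 * z\<^sup>2 - 0.00242 * z ^ 3 - 0.00114 * z ^ 4 - 0.000135 * z ^ 5)"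
    (is "_ \<ge> ?P")
  proof -
    have "?P = 2 * 0.09238 * z\<^sup>2 + 2 * 0.01872 * z ^ 3 - 2 * 0.00242 * z ^ 4 - 2 * 0.00114 * z ^ 5 - 2 * 0.000135 * z ^ 6"
      by (simp add: numeral_eq_Suc algebra_simps)
    moreover have p: "0 \<le> z\<^sup>2" "0 \<le> z ^ 3" "0 \<le> z ^ 4" "0 \<le> z ^ 5" "0 \<le> z ^ 6" using z0 by auto
    ultimately show ?thesis by (simp add: power_mult_distrib power_divide) (use p in linarith)
  qed
  ultimately have P: "?P \<le> s * (s * y - (s - 1) * y\<^sup>2)" by linarith
  have ez: "exp (- s * t\<^sup>2 / 6) = exp (- z)" by (simp add: z_def)
  have "\<bar>sin t / t\<bar> powr s \<le> (1 - y) powr s * exp (- z)"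
    using b(1) sinc_nonneg[OF t] unfolding ez by (simp only: abs_of_nonneg)
  also have "\<dots> \<le> (1 - (s * y - (s - 1) * y\<^sup>2)) * exp (- z)"
    using b s by (intro mult_right_mono one_minus_powr_le) auto
  finally have "(s * y - (s - 1) * y\<^sup>2) * exp (- z) \<le> exp (- z) - \<bar>sin t / t\<bar> powr s"
    by (simp add: algebra_simps)
  then have "s * ((s * y - (s - 1) * y\<^sup>2) * exp (- z)) \<le> s * (exp (- z) - \<bar>sin t / t\<bar> powr s)"
    using s0 by (intro mult_left_mono) auto
  moreover have "?P * exp (- z) \<le> s * (s * y - (s - 1) * y\<^sup>2) * exp (- z)"
    using P by (intro mult_right_mono) auto
  ultimately have "?P * exp (- z) \<le> s * (exp (- z) - \<bar>sin t / t\<bar> powr s)"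
    unfolding mult.assoc[of s] by (rule order_trans[rotated])
  then show ?thesis by (simp only: mult_ac)
qed

lemma sinc_powr_gap_large:
  fixes t s :: real
  assumes t: "0 < t" "t \<le> pi" and s: "2 \<le> s"
  defines "z \<equiv> s * t\<^sup>2 / 6"
  shows "2 * z * exp (- z) * (0.09238 * z - 0.00427 * z ^ 3)
    \<le> s * (exp (- z) - \<bar>sin t / t\<bar> powr s)"
proof -
  define w where "w = 0.6079 * (t\<^sup>2 / 6)"
  define y where "y = w\<^sup>2 / 2 + w ^ 3 / 3"
  have s0: "0 < s" using s by simp
  note b = sinc_powr_le[OF t s0, folded w_def, folded y_def]
  have z0: "0 \<le> z" using s0 by (simp add: z_def)
  have wz: "w = 0.6079 * z / s" using s0 by (simp add: z_def w_def)
  define q where "q = s * w\<^sup>2 / 2"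
  have q0: "0 \<le> q" using s0 by (simp add: q_def)
  have "0 \<le> w" by (simp add: w_def)
  \<comment> \<open>The quadratic majorant used for \<open>s \<le> 2\<close> is replaced by an
    exponential one; the cubic term of \<open>y\<close> is given up.\<close>
  have "(1 - y) powr s \<le> exp (- w\<^sup>2 / 2) powr s"
  proof (intro powr_mono2)
    have "1 - y \<le> 1 - w\<^sup>2 / 2" using \<open>0 \<le> w\<close> by (simp add: y_def)
    also have "\<dots> \<le> exp (- w\<^sup>2 / 2)" using exp_ge_add_one_self[of "- w\<^sup>2 / 2"] by simp
    finally show "1 - y \<le> exp (- w\<^sup>2 / 2)" .
  qed (use b s0 in auto)
  also have "\<dots> = exp (- q)" by (simp add: powr_def q_def)
  also have "\<dots> \<le> 1 - q + q\<^sup>2 / 2"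
  proof -
    have "1 + q + q\<^sup>2 / 2 \<le> exp q" using q0 by (rule exp_lower_Taylor_quadratic)
    then have "exp (- q) \<le> 1 / (1 + q + q\<^sup>2 / 2)"
      using q0 by (simp add: exp_minus inverse_eq_divide frac_le add_pos_nonneg)
    also have "\<dots> \<le> 1 - q + q\<^sup>2 / 2"
    proof -
      \<comment> \<open>The product equals 1 + q^4 / 4.\<close>
      have "1 \<le> (1 - q + q\<^sup>2 / 2) * (1 + q + q\<^sup>2 / 2)"
        using q0 by (simp add: field_simps power2_eq_square)
      moreover have "0 < 1 + q + q\<^sup>2 / 2" using q0 by (intro add_pos_nonneg) auto
      ultimately show ?thesis by (subst pos_divide_le_eq)
    qed
    finally show ?thesis .
  qed
  finally have q: "(1 - y) powr s \<le> 1 - q + q\<^sup>2 / 2" .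
  have ez: "exp (- s * t\<^sup>2 / 6) = exp (- z)" by (simp add: z_def)
  have "\<bar>sin t / t\<bar> powr s \<le> (1 - y) powr s * exp (- z)"
    using b(1) sinc_nonneg[OF t] unfolding ez by (simp only: abs_of_nonneg)
  also have "\<dots> \<le> (1 - q + q\<^sup>2 / 2) * exp (- z)"
    using q by (intro mult_right_mono) auto
  finally have "(q - q\<^sup>2 / 2) * exp (- z) \<le> exp (- z) - \<bar>sin t / t\<bar> powr s"
    by (simp add: algebra_simps)
  then have "s * ((q - q\<^sup>2 / 2) * exp (- z)) \<le> s * (exp (- z) - \<bar>sin t / t\<bar> powr s)"
    using s0 by (intro mult_left_mono) auto
  moreover have "2 * z * (0.09238 * z - 0.00427 * z ^ 3) * exp (- z) \<le> s * (q - q\<^sup>2 / 2) * exp (- z)"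
  proof (intro mult_right_mono)
    have "s * (q - q\<^sup>2 / 2) = (0.6079 * z)\<^sup>2 / 2 - (0.6079 * z) ^ 4 / 8 * (1 / s)"
      unfolding q_def wz using s0 by (simp add: field_simps numeral_eq_Suc)
    also have "\<dots> \<ge> (0.6079 * z)\<^sup>2 / 2 - (0.6079 * z) ^ 4 / 8 * (1 / 2)"
      using s z0 by (intro diff_mono mult_left_mono) (auto simp: field_simps)
    finally have "(0.6079 * z)\<^sup>2 / 2 - (0.6079 * z) ^ 4 / 8 * (1 / 2) \<le> s * (q - q\<^sup>2 / 2)" .
    moreover have p: "0 \<le> z\<^sup>2" "0 \<le> z ^ 4" by auto
    moreover have "2 * z * (0.09238 * z - 0.00427 * z ^ 3) = 2 * 0.09238 * z\<^sup>2 - 2 * 0.00427 * z ^ 4"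
      by (simp add: numeral_eq_Suc algebra_simps)
    ultimately show "2 * z * (0.09238 * z - 0.00427 * z ^ 3) \<le> s * (q - q\<^sup>2 / 2)"
      by (simp add: power_mult_distrib power_divide) (use p in linarith)
  qed auto
  ultimately have "2 * z * (0.09238 * z - 0.00427 * z ^ 3) * exp (- z) \<le> s * (exp (- z) - \<bar>sin t / t\<bar> powr s)"
    unfolding mult.assoc[of s] by (rule order_trans[rotated])
  then show ?thesis by (simp only: mult_ac)
qed

subsection \<open>Comparison of powers of sinc with Gaussians\<close>


text \<open>On this half-line sin^2 may be replaced by its mean 1/2: the weight is decreasing and
  convex, and both oscillating boundary terms of \<open>F\<close> vanish at
  \<open>pi\<close>.\<close>

lemma powr_tail_bound:
  fixes s a b :: real
  assumes s: "0 < s" and ab: "0 \<le> a" "0 \<le> b"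
  shows "(\<integral>\<^sup>+t\<in>{pi..}. ennreal ((a + b * (sin t)\<^sup>2) * t powr (- s - 1)) \<partial>lborel)
    \<le> ennreal ((a + b / 2) * pi powr (- s) / s)"
proof -
  \<comment> \<open>Two integrations by parts of the \<open>cos (2 t)\<close> part of \<open>(sin t)\<^sup>2\<close>; the error term in \<open>f\<close> is nonnegative.\<close>
  define F where "F = (\<lambda>t::real. - (a + b / 2) * t powr (- s) / s - b * sin (2 * t) * t powr (- s - 1) / 4
    + b * (s + 1) / 8 * (cos (2 * t) - 1) * t powr (- s - 2))"
  define f where "f = (\<lambda>t::real. (a + b * (sin t)\<^sup>2) * t powr (- s - 1)
    + b * (s + 1) * (s + 2) / 8 * (1 - cos (2 * t)) * t powr (- s - 3))"
  have dF: "DERIV F t :> f t" if "pi \<le> t" for t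
  proof -
    have t: "0 < t" using that pi_gt_zero by linarith
    have "DERIV F t :> (a + b / 2) * t powr (- s - 1) 
      - b * (cos (2 * t) * 2 * t powr (- s - 1) + sin (2 * t) * ((- s - 1) * t powr (- s - 2))) / 4
      + b * (s + 1) / 8 * (- sin (2 * t) * 2 * t powr (- s - 2) + (cos (2 * t) - 1) * ((- s - 2) * t powr (- s - 3)))"
      unfolding F_def using s t
      by (auto intro!: derivative_eq_intros simp: field_simps)
    also have "(a + b / 2) * t powr (- s - 1) 
      - b * (cos (2 * t) * 2 * t powr (- s - 1) + sin (2 * t) * ((- s - 1) * t powr (- s - 2))) / 4
      + b * (s + 1) / 8 * (- sin (2 * t) * 2 * t powr (- s - 2) + (cos (2 * t) - 1) * ((- s - 2) * t powr (- s - 3))) = f t"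
      unfolding f_def cos_double_sin by (simp add: field_simps)
    finally show ?thesis .
  qed
  have f0: "0 \<le> f t" "(a + b * (sin t)\<^sup>2) * t powr (- s - 1) \<le> f t" for t
    using s ab by (auto simp: f_def)
  have lim: "(F \<longlongrightarrow> 0) at_top"
  proof -
    have p: "((\<lambda>t::real. t powr (- c)) \<longlongrightarrow> 0) at_top" if "c > 0" for c
      using that by (intro tendsto_neg_powr filterlim_ident) auto
    have 1: "((\<lambda>t::real. sin (2 * t) * t powr (- s - 1)) \<longlongrightarrow> 0) at_top"
    proof (rule Lim_null_comparison)
      show "\<forall>\<^sub>F t in at_top. norm (sin (2 * t) * t powr (- s - 1)) \<le> t powr (- (s + 1))"
        by (auto intro!: always_eventually simp: abs_mult mult_left_le_one_le)
    qed (use p[of "s + 1"] s in simp)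
    have 2: "((\<lambda>t::real. (cos (2 * t) - 1) * t powr (- s - 2)) \<longlongrightarrow> 0) at_top"
    proof (rule Lim_null_comparison)
      have "\<bar>cos (2 * t) - 1\<bar> \<le> 2" for t :: real
        using cos_ge_minus_one[of "2 * t"] cos_le_one[of "2 * t"] by linarith
      then show "\<forall>\<^sub>F t in at_top. norm ((cos (2 * t) - 1) * t powr (- s - 2)) \<le> 2 * t powr (- (s + 2))"
        by (auto intro!: always_eventually mult_right_mono simp: abs_mult)
    qed (use tendsto_mult[OF tendsto_const[of 2] p[of "s + 2"]] s in simp)
    have "F = (\<lambda>t. (- (a + b / 2) / s) * t powr (- s) - b / 4 * (sin (2 * t) * t powr (- s - 1))
      + b * (s + 1) / 8 * ((cos (2 * t) - 1) * t powr (- s - 2)))"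
      by (simp add: F_def fun_eq_iff)
    moreover have "((\<lambda>t. (- (a + b / 2) / s) * t powr (- s) - b / 4 * (sin (2 * t) * t powr (- s - 1))
      + b * (s + 1) / 8 * ((cos (2 * t) - 1) * t powr (- s - 2))) \<longlongrightarrow> (- (a + b / 2) / s) * 0 - b / 4 * 0 + b * (s + 1) / 8 * 0) at_top"
      using 1 2 p[of s] s by (intro tendsto_add tendsto_diff tendsto_mult tendsto_const)
    ultimately have "(F \<longlongrightarrow> (- (a + b / 2) / s) * 0 - b / 4 * 0 + b * (s + 1) / 8 * 0) at_top"
      by simp
    then show ?thesis by simp
  qed
  have "(\<integral>\<^sup>+t\<in>{pi..}. ennreal ((a + b * (sin t)\<^sup>2) * t powr (- s - 1)) \<partial>lborel)
    \<le> (\<integral>\<^sup>+t. ennreal (f t) * indicator {pi..} t \<partial>lborel)"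
    using f0 by (intro nn_integral_mono mult_right_mono ennreal_leI) auto
  also have "\<dots> = 0 - F pi"
    using dF f0 lim by (intro nn_integral_FTC_atLeast) (auto simp: f_def)
  also have "0 - F pi = (a + b / 2) * pi powr (- s) / s" using s by (simp add: F_def) (simp add: field_simps)
  finally show ?thesis by simp
qed

definition gauss_poly :: "real \<Rightarrow> real \<Rightarrow> real \<Rightarrow> real \<Rightarrow> real \<Rightarrow> real \<Rightarrow> real" where
  "gauss_poly b1 b2 b3 b4 b5 z = b1 * z + b2 * z\<^sup>2 + b3 * z ^ 3 + b4 * z ^ 4 + b5 * z ^ 5"

text \<open>\<open>S\<close> is the sum of the polynomial R and all its derivatives, so S' = S - R
  and - exp (-z) S(z) is an antiderivative of exp (-z) R(z). The substitution z = s t^2 / 6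
  contributes the factor 1 / s.\<close>

lemma nn_integral_gauss_poly:
  fixes s zm :: real and b1 b2 b3 b4 b5
  assumes s: "0 < s" and zm: "0 \<le> zm"
    and nonneg: "\<And>z. 0 \<le> z \<Longrightarrow> z \<le> zm \<Longrightarrow> 0 \<le> gauss_poly b1 b2 b3 b4 b5 z"
  defines "S \<equiv> \<lambda>z. (b1 + 2 * b2 + 6 * b3 + 24 * b4 + 120 * b5) * (1 + z)
    + (b2 + 3 * b3 + 12 * b4 + 60 * b5) * z\<^sup>2 + (b3 + 4 * b4 + 20 * b5) * z ^ 3 + (b4 + 5 * b5) * z ^ 4 + b5 * z ^ 5"
  shows "(\<integral>\<^sup>+t\<in>{0..sqrt (6 * zm / s)}. ennreal (exp (- (s * t\<^sup>2 / 6)) * gauss_poly b1 b2 b3 b4 b5 (s * t\<^sup>2 / 6) * t / 3) \<partial>lborel)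
    = ennreal ((S 0 - exp (- zm) * S zm) / s)"
proof -
  define F where "F = (\<lambda>t. - exp (- (s * t\<^sup>2 / 6)) * S (s * t\<^sup>2 / 6) / s)"
  have "(\<integral>\<^sup>+t\<in>{0..sqrt (6 * zm / s)}. ennreal (exp (- (s * t\<^sup>2 / 6)) * gauss_poly b1 b2 b3 b4 b5 (s * t\<^sup>2 / 6) * t / 3) \<partial>lborel)
    = F (sqrt (6 * zm / s)) - F 0"
  proof (rule nn_integral_FTC_Icc)
    fix t assume "t \<in> {0..sqrt (6 * zm / s)}"
    then have t: "0 \<le> t" "t \<le> sqrt (6 * zm / s)" by auto
    define z where "z = s * t\<^sup>2 / 6"
    have dS: "(S has_real_derivative S z - gauss_poly b1 b2 b3 b4 b5 z) (at z)" for z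
      unfolding S_def gauss_poly_def
      by (auto intro!: derivative_eq_intros simp: algebra_simps numeral_eq_Suc)
    have dz: "((\<lambda>t. s * t\<^sup>2 / 6) has_real_derivative s * t / 3) (at t)"
      by (auto intro!: derivative_eq_intros)
    have dSz: "((\<lambda>t. S (s * t\<^sup>2 / 6)) has_real_derivative (S z - gauss_poly b1 b2 b3 b4 b5 z) * (s * t / 3)) (at t)"
      unfolding z_def by (rule DERIV_chain2[OF dS dz])
    have "(F has_real_derivative exp (- z) * gauss_poly b1 b2 b3 b4 b5 z * t / 3) (at t)"
      unfolding F_def using s
      by (auto intro!: derivative_eq_intros dSz simp: z_def[symmetric]) (simp add: field_simps z_def)
    then show "(F has_real_derivative exp (- (s * t\<^sup>2 / 6)) * gauss_poly b1 b2 b3 b4 b5 (s * t\<^sup>2 / 6) * t / 3) (at t)"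
      by (simp only: z_def)
    have "t\<^sup>2 \<le> 6 * zm / s" using t s zm by (metis abs_of_nonneg real_sqrt_abs real_sqrt_le_iff)
    then have "z \<le> zm" "0 \<le> z" using s by (auto simp: z_def field_simps)
    then show "0 \<le> exp (- (s * t\<^sup>2 / 6)) * gauss_poly b1 b2 b3 b4 b5 (s * t\<^sup>2 / 6) * t / 3"
      using nonneg[of z] t by (simp add: z_def)
  next
    show "0 \<le> sqrt (6 * zm / s)" using s zm by simp
  qed (auto simp: gauss_poly_def)
  also have "F (sqrt (6 * zm / s)) - F 0 = (S 0 - exp (- zm) * S zm) / s"
    using s zm by (simp add: F_def diff_divide_distrib)
  finally show ?thesis .
qed


text \<open>After factoring out \<open>z\<close>, the negative coefficients are worst at the right
  end; 7.84, 21.952 and 61.4656 are the powers of 14/5.\<close>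

lemma gauss_poly_ge:
  assumes "b3 \<le> 0" "b4 \<le> 0" "b5 \<le> 0" "0 \<le> b2" "0 \<le> z" "z \<le> (14/5::real)"
    and "0 \<le> b1 + b3 * 7.84 + b4 * 21.952 + b5 * 61.4656"
  shows "0 \<le> gauss_poly b1 b2 b3 b4 b5 z"
proof -
  have "z\<^sup>2 \<le> (14/5)\<^sup>2" "z ^ 3 \<le> (14/5) ^ 3" "z ^ 4 \<le> (14/5) ^ 4"
    using assms by (auto intro!: power_mono simp del: power_divide)
  then have "z\<^sup>2 \<le> 7.84" "z ^ 3 \<le> 21.952" "z ^ 4 \<le> 61.4656" by (simp_all add: power_divide)
  then have "b3 * 7.84 \<le> b3 * z\<^sup>2" "b4 * 21.952 \<le> b4 * z ^ 3" "b5 * 61.4656 \<le> b5 * z ^ 4" "0 \<le> b2 * z"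
    using assms by - (rule mult_left_mono_neg mult_nonneg_nonneg; assumption)+
  then have "0 \<le> b1 + b2 * z + b3 * z\<^sup>2 + b4 * z ^ 3 + b5 * z ^ 4"
    using assms by linarith
  then have "0 \<le> z * (b1 + b2 * z + b3 * z\<^sup>2 + b4 * z ^ 3 + b5 * z ^ 4)"
    using assms by simp
  then show ?thesis by (simp add: gauss_poly_def numeral_eq_Suc algebra_simps)
qed

text \<open>The left side is a decreasing power of 2 pi^2 >= 19.7392, so \<open>s = 43/25\<close> is
  the worst case. Raising to the 50th power makes the exponent 43/50 an integer and leaves a
  rational comparison.\<close>

lemma two_pi_squared_powr_le:
  assumes "43/25 \<le> s"
  shows "2 powr (- s / 2) * pi powr (- s) \<le> 0.0775"
proof -
  have "2 powr (- s / 2) * pi powr (- s) = (2 * pi\<^sup>2) powr (- s / 2)"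
    by (simp add: powr_mult powr_powr flip: powr_numeral)
  also have "\<dots> \<le> (2 * pi\<^sup>2) powr (- (43 / 50))"
    using assms pi_squared_bounds by (intro powr_mono) auto
  also have "\<dots> \<le> 19.7392 powr (- (43 / 50))"
    using pi_squared_bounds by (intro powr_mono2') auto
  also have "\<dots> \<le> 0.0775"
  proof -
    have "(19.7392 powr (- (43 / 50))) ^ 50 = (19.7392 powr (- 43) :: real)"
      by (simp add: powr_powr flip: powr_realpow)
    also have "\<dots> = 1 / 19.7392 ^ 43"
      by (simp add: powr_minus_divide)
    also have "\<dots> \<le> 0.0775 ^ 50"
      by (simp add: power_divide)
    finally show ?thesis
      by (subst (asm) power_mono_iff) auto
  qed
  finally show ?thesis .
qed

text \<open>\<open>A / s\<close> bounds the gain before \<open>pi\<close> from below and the loss after \<open>pi\<close> from above, both for \<open>p = 0\<close>.\<close>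

lemma sinc_power_gain_tail:
  fixes s :: real
  assumes s: "43/25 \<le> s"
  obtains g :: "real \<Rightarrow> real" and t1 A a b where "g \<in> borel_measurable borel"
    "0 < t1" "t1 \<le> pi" "\<And>t. 0 < t \<Longrightarrow> t \<le> t1 \<Longrightarrow> 0 \<le> g t \<and> g t \<le> (exp (- (s * t\<^sup>2 / 6)) - \<bar>sin t / t\<bar> powr s) / t"
    "(\<integral>\<^sup>+t\<in>{0..t1}. ennreal (g t) \<partial>lborel) = ennreal (A / s)"
    "0 \<le> a" "0 \<le> b" "\<And>t. \<bar>sin t\<bar> powr s \<le> a + b * (sin t)\<^sup>2" "(a + b / 2) * pi powr (- s) \<le> A"
proof -
  \<comment> \<open>The gain is only collected up to z = s t^2 / 6 = 14/5. This end does not depend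
    on \<open>s\<close>, and since (43/25) pi^2 / 6 exceeds 14/5 it is reached before
    \<open>pi\<close> for every admissible \<open>s\<close>.\<close>
  define t1 where "t1 = sqrt (6 * (14/5) / s)"
  have s0: "0 < s" using s by simp
  have t1: "0 < t1" using s0 by (simp add: t1_def)
  have "6 * (14/5) / s \<le> pi\<^sup>2"
  proof -
    have "6 * (14/5) \<le> (43/25) * (9.8696::real)" by simp
    also have "\<dots> \<le> s * pi\<^sup>2" using s pi_squared_bounds by (intro mult_mono) auto
    finally have "6 * (14/5) \<le> pi\<^sup>2 * s" by (simp only: mult.commute)
    then show ?thesis using s0 by (simp only: pos_divide_le_eq)
  qed
  then have t1_pi: "t1 \<le> pi" unfolding t1_def by (rule real_le_lsqrt[rotated]) auto
  have zle: "s * t\<^sup>2 / 6 \<le> 14/5" "0 \<le> s * t\<^sup>2 / 6" if "0 < t" "t \<le> t1" for t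
  proof -
    have "t\<^sup>2 \<le> t1\<^sup>2" using that by (intro power_mono) auto
    also have "\<dots> = 6 * (14/5) / s" using s0 by (simp add: t1_def)
    finally show "s * t\<^sup>2 / 6 \<le> 14/5" using s0 by (simp add: field_simps)
  qed (use s0 in auto)
  \<comment> \<open>As dz = (s / 3) t dt, the factor 2 z in the gap bounds turns the gain over dt /
    t into exp (-z) R(z) dz / s, whose 1 / s matches that of the tail bound.\<close>
  have g_le: "exp (- z) * R * t / 3 \<le> X / t"
    if "2 * z * exp (- z) * R \<le> s * X" "z = s * t\<^sup>2 / 6" "0 < t" for z R X t
  proof -
    have "s * (exp (- z) * R * t\<^sup>2 / 3) \<le> s * X" using that(1) unfolding that(2) by (simp add: field_simps)
    then have "exp (- z) * R * t\<^sup>2 / 3 \<le> X" using s0 by simp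
    then show ?thesis using that(3) by (simp add: field_simps power2_eq_square)
  qed
  \<comment> \<open>The end value of the antiderivative enters with a plus sign for
    \<open>s \<le> 2\<close> and with a minus sign otherwise, hence bounds on both sides.\<close>
  have exp28: "1/27 \<le> exp (- (14/5::real))" "exp (- (14/5::real)) \<le> 1/5"
  proof -
    have "exp (14/5::real) \<le> exp 3" by simp
    also have "\<dots> = exp 1 ^ 3" by (simp flip: exp_of_nat_mult)
    also have "\<dots> \<le> 3 ^ 3" using exp_le by (intro power_mono) auto
    finally have "exp (14/5::real) \<le> 27" by simp
    then show "1/27 \<le> exp (- (14/5::real))" by (simp add: exp_minus field_simps)
    have "1 + 14/5 + (14/5)\<^sup>2/2 \<le> exp (14/5::real)" by (rule exp_lower_Taylor_quadratic) simp
    then have "5 \<le> exp (14/5::real)" by (simp add: power2_eq_square)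
    then show "exp (- (14/5::real)) \<le> 1/5" by (simp add: exp_minus field_simps)
  qed
  show thesis
  proof (cases "s \<le> 2")
    case True
    let ?R = "gauss_poly 0.09238 0.01872 (-0.00242) (-0.00114) (-0.000135)"
    have R0: "0 \<le> ?R z" if "0 \<le> z" "z \<le> 14/5" for z
      using that by (intro gauss_poly_ge) auto
    show thesis
    proof (rule that[OF _ t1 t1_pi])
      show "(\<lambda>t. exp (- (s * t\<^sup>2 / 6)) * ?R (s * t\<^sup>2 / 6) * t / 3) \<in> borel_measurable borel"
        by (simp add: gauss_poly_def)
      show "(\<integral>\<^sup>+t\<in>{0..t1}. ennreal (exp (- (s * t\<^sup>2 / 6)) * ?R (s * t\<^sup>2 / 6) * t / 3) \<partial>lborel)
        = ennreal ((0.07174 + exp (- (14/5)) * 0.1555862208) / s)"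
        unfolding t1_def using nn_integral_gauss_poly[where zm = "14/5", OF s0 _ R0] by (simp add: power_divide)
      show "\<bar>sin t\<bar> powr s \<le> 2 powr (- s / 2) * (1 - s / 2) + 2 powr (- s / 2) * s * (sin t)\<^sup>2" for t :: real
      proof -
        have "\<bar>sin t\<bar> powr s = ((sin t)\<^sup>2) powr (s / 2)"
        proof (cases "sin t = 0")
          case False
          then have "(sin t)\<^sup>2 = \<bar>sin t\<bar> powr 2" by simp
          then show ?thesis by (simp only: powr_powr) simp
        qed simp
        also have "\<dots> = 2 powr (- s / 2) * (2 * (sin t)\<^sup>2) powr (s / 2)"
          by (simp add: powr_mult powr_minus)
        \<comment> \<open>Tangent at \<open>(sin t)\<^sup>2 = 1/2\<close>, its mean value, so that the average of the bound is optimal.\<close>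
        also have "\<dots> \<le> 2 powr (- s / 2) * (1 + s / 2 * (2 * (sin t)\<^sup>2 - 1))"
          using True s0 by (intro mult_left_mono powr_le_tangent_one) auto
        finally show ?thesis by (simp add: algebra_simps)
      qed
      have "(2 powr (- s / 2) * (1 - s / 2) + 2 powr (- s / 2) * s / 2) * pi powr (- s)
        = 2 powr (- s / 2) * pi powr (- s)" by (simp add: algebra_simps)
      also have "\<dots> \<le> 0.0775" by (rule two_pi_squared_powr_le[OF s])
      \<comment> \<open>The tightest comparison of gain and loss: with 1/27 in place of the
        exponential the right side is about 0.0775025.\<close>
      also have "\<dots> \<le> 0.07174 + exp (- (14/5)) * 0.1555862208" using exp28 by simp
      finally show "(2 powr (- s / 2) * (1 - s / 2) + 2 powr (- s / 2) * s / 2) * pi powr (- s)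
        \<le> 0.07174 + exp (- (14/5)) * 0.1555862208" .
    next
      fix t assume t: "0 < t" "t \<le> t1"
      then show "0 \<le> exp (- (s * t\<^sup>2 / 6)) * ?R (s * t\<^sup>2 / 6) * t / 3 \<and>
        exp (- (s * t\<^sup>2 / 6)) * ?R (s * t\<^sup>2 / 6) * t / 3 \<le> (exp (- (s * t\<^sup>2 / 6)) - \<bar>sin t / t\<bar> powr s) / t"
        using zle[of t] R0[of "s * t\<^sup>2 / 6"] sinc_powr_gap_small[OF t(1) _ s True] t1_pi
        by (intro conjI g_le) (auto simp: gauss_poly_def)
    qed (use True s0 in auto)
  next
    case False
    let ?R = "gauss_poly 0.09238 0 (-0.00427) 0 0"
    have R0: "0 \<le> ?R z" if "0 \<le> z" "z \<le> 14/5" for z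
      using that by (intro gauss_poly_ge) auto
    show thesis
    proof (rule that[OF _ t1 t1_pi])
      show "(\<lambda>t. exp (- (s * t\<^sup>2 / 6)) * ?R (s * t\<^sup>2 / 6) * t / 3) \<in> borel_measurable borel"
        by (simp add: gauss_poly_def)
      show "(\<integral>\<^sup>+t\<in>{0..t1}. ennreal (exp (- (s * t\<^sup>2 / 6)) * ?R (s * t\<^sup>2 / 6) * t / 3) \<partial>lborel)
        = ennreal ((0.06676 - exp (- (14/5)) * 0.05952256) / s)"
        unfolding t1_def using nn_integral_gauss_poly[where zm = "14/5", OF s0 _ R0] by (simp add: power_divide)
      show "\<bar>sin t\<bar> powr s \<le> 0 + 1 * (sin t)\<^sup>2" for t :: real
      proof -
        have "\<bar>sin t\<bar> powr s \<le> \<bar>sin t\<bar> powr 2"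
          using False by (intro powr_mono') auto
        then show ?thesis by simp
      qed
      have "pi powr (- s) \<le> pi powr (- 2)" using False pi_gt3 by (intro powr_mono) auto
      also have "\<dots> \<le> 1 / 9.8696" using pi_squared_bounds by (simp add: powr_minus_divide field_simps)
      finally show "(0 + 1 / 2) * pi powr (- s) \<le> 0.06676 - exp (- (14/5)) * 0.05952256" using exp28 by simp
    next
      fix t assume t: "0 < t" "t \<le> t1"
      then show "0 \<le> exp (- (s * t\<^sup>2 / 6)) * ?R (s * t\<^sup>2 / 6) * t / 3 \<and>
        exp (- (s * t\<^sup>2 / 6)) * ?R (s * t\<^sup>2 / 6) * t / 3 \<le> (exp (- (s * t\<^sup>2 / 6)) - \<bar>sin t / t\<bar> powr s) / t"
        using zle[of t] R0[of "s * t\<^sup>2 / 6"] sinc_powr_gap_large[OF t(1)] t1_pi False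
        by (intro conjI g_le) (auto simp: gauss_poly_def)
    qed auto
  qed
qed


text \<open>Gain \<open>h\<close> and loss \<open>e\<close> are added on opposite sides,
  \<open>v + h \<le> u + e\<close>, so that nothing is subtracted in \<open>ennreal\<close>. Both
  have the bound \<open>pi powr (- p) * A / s\<close> in common, exact for \<open>h\<close>, and the
  finite integral of \<open>h\<close> can be cancelled.\<close>

lemma set_nn_integral_sinc_gauss:
  fixes s p :: real
  assumes s: "43/25 \<le> s" and p: "0 < p"
  shows "(\<integral>\<^sup>+t\<in>{0<..}. ennreal ((1 - exp (- (s * t\<^sup>2 / 6))) * t powr (- p - 1)) \<partial>lborel)
    \<le> (\<integral>\<^sup>+t\<in>{0<..}. ennreal ((1 - \<bar>sin t / t\<bar> powr s) * t powr (- p - 1)) \<partial>lborel)"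
    (is "?V \<le> ?U")
proof -
  obtain g t1 A a b where [measurable]: "g \<in> borel_measurable borel" and
    t1: "0 < t1" "t1 \<le> pi" and
    g: "\<And>t. 0 < t \<Longrightarrow> t \<le> t1 \<Longrightarrow> 0 \<le> g t \<and> g t \<le> (exp (- (s * t\<^sup>2 / 6)) - \<bar>sin t / t\<bar> powr s) / t" and
    A: "(\<integral>\<^sup>+t\<in>{0..t1}. ennreal (g t) \<partial>lborel) = ennreal (A / s)" and
    ab: "0 \<le> a" "0 \<le> b" "\<And>t. \<bar>sin t\<bar> powr s \<le> a + b * (sin t)\<^sup>2" "(a + b / 2) * pi powr (- s) \<le> A"
    by (rule sinc_power_gain_tail[OF s]) blast
  have s0: "0 < s" using s by simp
  define u where "u = (\<lambda>t. ennreal ((1 - \<bar>sin t / t\<bar> powr s) * t powr (- p - 1)) * indicator {0<..} t)"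
  define v where "v = (\<lambda>t. ennreal ((1 - exp (- (s * t\<^sup>2 / 6))) * t powr (- p - 1)) * indicator {0<..} t)"
  define e where "e = (\<lambda>t. ennreal (pi powr (- p)) * (ennreal ((a + b * (sin t)\<^sup>2) * t powr (- s - 1)) * indicator {pi..} t))"
  define h where "h = (\<lambda>t. ennreal (pi powr (- p)) * (ennreal (g t) * indicator {0..t1} t))"
  have [measurable]: "u \<in> borel_measurable lborel" "v \<in> borel_measurable lborel"
    "e \<in> borel_measurable lborel" "h \<in> borel_measurable lborel"
    unfolding u_def v_def e_def h_def by measurable
  have nn: "0 \<le> 1 - \<bar>sin t / t\<bar> powr s" "0 \<le> 1 - exp (- (s * t\<^sup>2 / 6))" for t :: real
    using sinc_le_one[of t] s0 powr_mono2[of s "\<bar>sin t / t\<bar>" 1] by auto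
  have pointwise: "v t + h t \<le> u t + e t" if "t \<noteq> 0" for t
  proof (cases "t < 0")
    case True
    then show ?thesis using t1 by (simp add: u_def v_def e_def h_def)
  next
    case False
    then have t: "0 < t" using that by simp
    consider "t \<le> t1" | "t1 < t" "t \<le> pi" | "pi < t" by linarith
    then show ?thesis
    proof cases
      case 1
      have "pi powr (- p) \<le> t powr (- p)" using 1 t t1 p by (intro powr_mono2') auto
      then have "pi powr (- p) * g t \<le> t powr (- p) * ((exp (- (s * t\<^sup>2 / 6)) - \<bar>sin t / t\<bar> powr s) / t)"
        using g[OF t 1] by (intro mult_mono) auto
      also have "\<dots> = (exp (- (s * t\<^sup>2 / 6)) - \<bar>sin t / t\<bar> powr s) * t powr (- p - 1)"
        using t by (simp add: powr_diff field_simps)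
      finally have "(1 - exp (- (s * t\<^sup>2 / 6))) * t powr (- p - 1) + pi powr (- p) * g t
          \<le> (1 - \<bar>sin t / t\<bar> powr s) * t powr (- p - 1)"
        by (simp add: algebra_simps)
      moreover have "v t + h t = ennreal ((1 - exp (- (s * t\<^sup>2 / 6))) * t powr (- p - 1) + pi powr (- p) * g t)"
        using t 1 g[OF t 1] nn[of t] by (simp add: v_def h_def ennreal_plus ennreal_mult)
      ultimately have "v t + h t \<le> u t" using t by (simp add: u_def ennreal_leI)
      then show ?thesis by (rule order_trans) simp
    next
      case 2
      have "\<bar>sin t / t\<bar> powr s \<le> exp (- (s * t\<^sup>2 / 6))"
        using sinc_powr_gap_nonneg[OF t 2(2) s0] by simp
      then have "v t \<le> u t" using t unfolding u_def v_def
        by (intro mult_right_mono ennreal_leI) auto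
      moreover have "h t = 0" using 2 by (simp add: h_def)
      ultimately show ?thesis by (simp add: add_increasing2)
    next
      case 3
      have "t powr (- p) \<le> pi powr (- p)" using 3 p by (intro powr_mono2') auto
      have "\<bar>sin t / t\<bar> powr s * t powr (- p - 1) = t powr (- p) * (\<bar>sin t\<bar> powr s * t powr (- s - 1))"
        using t by (simp add: powr_divide powr_diff powr_minus field_simps abs_divide)
      also have "\<dots> \<le> pi powr (- p) * ((a + b * (sin t)\<^sup>2) * t powr (- s - 1))"
        using ab(3)[of t] ab(1,2) \<open>t powr (- p) \<le> pi powr (- p)\<close> by (intro mult_mono) auto
      finally have le: "\<bar>sin t / t\<bar> powr s * t powr (- p - 1) \<le> pi powr (- p) * ((a + b * (sin t)\<^sup>2) * t powr (- s - 1))" .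
      have "(1 - exp (- (s * t\<^sup>2 / 6))) * t powr (- p - 1) \<le> 1 * t powr (- p - 1)"
        by (intro mult_right_mono) auto
      with le have "(1 - exp (- (s * t\<^sup>2 / 6))) * t powr (- p - 1) \<le> (1 - \<bar>sin t / t\<bar> powr s) * t powr (- p - 1)
        + pi powr (- p) * ((a + b * (sin t)\<^sup>2) * t powr (- s - 1))"
        unfolding left_diff_distrib by linarith
      moreover have "u t + e t = ennreal ((1 - \<bar>sin t / t\<bar> powr s) * t powr (- p - 1)
        + pi powr (- p) * ((a + b * (sin t)\<^sup>2) * t powr (- s - 1)))"
        using t 3 nn[of t] ab(1,2) by (simp add: u_def e_def ennreal_plus ennreal_mult)
      ultimately have "v t \<le> u t + e t" using t by (simp add: v_def ennreal_leI)
      moreover have "h t = 0" using 3 t1 by (simp add: h_def)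
      ultimately show ?thesis by simp
    qed
  qed
  have "integral\<^sup>N lborel e = ennreal (pi powr (- p)) * (\<integral>\<^sup>+t\<in>{pi..}. ennreal ((a + b * (sin t)\<^sup>2) * t powr (- s - 1)) \<partial>lborel)"
    unfolding e_def by (intro nn_integral_cmult) measurable
  also have "\<dots> \<le> ennreal (pi powr (- p)) * ennreal ((a + b / 2) * pi powr (- s) / s)"
    by (intro mult_left_mono powr_tail_bound s0 ab) auto
  also have "\<dots> \<le> ennreal (pi powr (- p)) * ennreal (A / s)"
    using ab(4) s0 by (intro mult_left_mono ennreal_leI divide_right_mono) auto
  finally have e_le: "integral\<^sup>N lborel e \<le> ennreal (pi powr (- p)) * ennreal (A / s)" .
  have h_eq: "integral\<^sup>N lborel h = ennreal (pi powr (- p)) * ennreal (A / s)"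
    unfolding h_def A[symmetric] by (intro nn_integral_cmult) measurable
  have "integral\<^sup>N lborel h + integral\<^sup>N lborel v = (\<integral>\<^sup>+t. v t + h t \<partial>lborel)"
    by (simp add: nn_integral_add add.commute)
  also have "\<dots> \<le> (\<integral>\<^sup>+t. u t + e t \<partial>lborel)"
    using pointwise by (intro nn_integral_mono_AE AE_I[where N = "{0}"]) auto
  also have "\<dots> = integral\<^sup>N lborel e + integral\<^sup>N lborel u"
    by (simp add: nn_integral_add add.commute)
  also have "\<dots> \<le> integral\<^sup>N lborel h + integral\<^sup>N lborel u"
    using e_le h_eq by (intro add_right_mono) simp
  finally have "integral\<^sup>N lborel v \<le> integral\<^sup>N lborel u"
    unfolding ennreal_add_left_cancel_le h_eq by (simp add: ennreal_mult_eq_top_iff)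
  then show ?thesis by (simp only: u_def v_def)
qed

subsection \<open>Fourier representation of fractional moments\<close>

lemma nn_integral_powr_scale:
  fixes f :: "real \<Rightarrow> real" and c p :: real
  assumes [measurable]: "f \<in> borel_measurable borel" and c: "0 < c"
  shows "(\<integral>\<^sup>+t\<in>{0<..}. ennreal (f (c * t) * t powr (- p - 1)) \<partial>lborel)
    = ennreal (c powr p) * (\<integral>\<^sup>+t\<in>{0<..}. ennreal (f t * t powr (- p - 1)) \<partial>lborel)"
proof -
  have "(\<integral>\<^sup>+t\<in>{0<..}. ennreal (f t * t powr (- p - 1)) \<partial>lborel)
    = ennreal \<bar>c\<bar> * (\<integral>\<^sup>+t. ennreal (f (0 + c * t) * (0 + c * t) powr (- p - 1)) * indicator {0<..} (0 + c * t) \<partial>lborel)"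
    using c by (intro nn_integral_real_affine) auto
  also have "(\<integral>\<^sup>+t. ennreal (f (0 + c * t) * (0 + c * t) powr (- p - 1)) * indicator {0<..} (0 + c * t) \<partial>lborel)
    = (\<integral>\<^sup>+t. ennreal (c powr (- p - 1)) * (ennreal (f (c * t) * t powr (- p - 1)) * indicator {0<..} t) \<partial>lborel)"
  proof (intro nn_integral_cong)
    fix t :: real
    show "ennreal (f (0 + c * t) * (0 + c * t) powr (- p - 1)) * indicator {0<..} (0 + c * t)
      = ennreal (c powr (- p - 1)) * (ennreal (f (c * t) * t powr (- p - 1)) * indicator {0<..} t)"
    proof (cases "0 < t")
      case True
      then have "f (c * t) * (c * t) powr (- p - 1) = c powr (- p - 1) * (f (c * t) * t powr (- p - 1))"
        using c by (simp add: powr_mult)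
      then have "ennreal (f (c * t) * (c * t) powr (- p - 1)) = ennreal (c powr (- p - 1)) * ennreal (f (c * t) * t powr (- p - 1))"
        by (simp only: ennreal_mult'[OF powr_ge_zero])
      then show ?thesis using c True by simp
    qed (use c in \<open>auto simp: zero_less_mult_iff\<close>)
  qed
  also have "\<dots> = ennreal (c powr (- p - 1)) * (\<integral>\<^sup>+t\<in>{0<..}. ennreal (f (c * t) * t powr (- p - 1)) \<partial>lborel)"
    by (intro nn_integral_cmult) measurable
  finally have "ennreal (c powr p) * (\<integral>\<^sup>+t\<in>{0<..}. ennreal (f t * t powr (- p - 1)) \<partial>lborel)
    = ennreal (c powr p) * (ennreal \<bar>c\<bar> * (ennreal (c powr (- p - 1)) * (\<integral>\<^sup>+t\<in>{0<..}. ennreal (f (c * t) * t powr (- p - 1)) \<partial>lborel)))"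
    by simp
  also have "\<dots> = ennreal (c powr p * (c * c powr (- p - 1))) * (\<integral>\<^sup>+t\<in>{0<..}. ennreal (f (c * t) * t powr (- p - 1)) \<partial>lborel)"
    using c by (simp add: ennreal_mult mult.assoc)
  also have "c powr p * (c * c powr (- p - 1)) = 1"
    using c by (simp add: powr_mult_base flip: powr_add)
  finally show ?thesis by simp
qed

text \<open>The constant of proportionality between E |X|^p and its Fourier integral. It is
  cancelled at the end, for which its being positive and finite suffices.\<close>

definition cos_moment :: "real \<Rightarrow> ennreal" where
  "cos_moment p = (\<integral>\<^sup>+t\<in>{0<..}. ennreal ((1 - cos t) * t powr (- p - 1)) \<partial>lborel)"

text \<open>Near 0 the integrand is t^(1-p) <= 1, beyond 1 it is at most an integrable power. The
  same majorant makes \<open>cos_moment\<close> finite and dominates the integrands in the limit of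
  equal coefficients.\<close>

lemma nn_integral_powr_dominator:
  fixes p :: real
  assumes "0 < p" "p < 1"
  shows "(\<integral>\<^sup>+t\<in>{0<..}. ennreal (min 2 (t\<^sup>2) * t powr (- p - 1)) \<partial>lborel) < \<infinity>"
proof -
  define F where "F = (\<lambda>t::real. - (2 / p) * t powr (- p))"
  have "(\<integral>\<^sup>+t\<in>{0<..}. ennreal (min 2 (t\<^sup>2) * t powr (- p - 1)) \<partial>lborel)
    \<le> (\<integral>\<^sup>+t. indicator {0..1} t + ennreal (2 * t powr (- p - 1)) * indicator {1..} t \<partial>lborel)"
  proof (intro nn_integral_mono)
    fix t :: real
    show "ennreal (min 2 (t\<^sup>2) * t powr (- p - 1)) * indicator {0<..} t
      \<le> indicator {0..1} t + ennreal (2 * t powr (- p - 1)) * indicator {1..} t"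
    proof (cases "0 < t \<and> t < 1")
      case True
      then have "min 2 (t\<^sup>2) * t powr (- p - 1) \<le> t powr 2 * t powr (- p - 1)"
        by (intro mult_right_mono) auto
      also have "\<dots> = t powr (1 - p)" by (simp flip: powr_add)
      also have "\<dots> \<le> 1" using True assms by (intro powr_le1) auto
      finally show ?thesis using True by simp
    next
      case False
      then show ?thesis
        by (cases "t \<le> 0") (auto simp: indicator_def intro!: add_increasing ennreal_leI mult_right_mono)
    qed
  qed
  also have "\<dots> = 1 + (\<integral>\<^sup>+t. ennreal (2 * t powr (- p - 1)) * indicator {1..} t \<partial>lborel)"
    by (subst nn_integral_add) auto
  also have "(\<integral>\<^sup>+t. ennreal (2 * t powr (- p - 1)) * indicator {1..} t \<partial>lborel) = 0 - F 1"
  proof (rule nn_integral_FTC_atLeast)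
    show "DERIV F t :> 2 * t powr (- p - 1)" if "1 \<le> t" for t
      using that assms unfolding F_def by (auto intro!: derivative_eq_intros)
    have "((\<lambda>t::real. t powr (- p)) \<longlongrightarrow> 0) at_top"
      using assms by (intro tendsto_neg_powr filterlim_ident) auto
    from tendsto_mult[OF tendsto_const[of "- (2/p)"] this] show "(F \<longlongrightarrow> 0) at_top"
      by (simp add: F_def)
  qed auto
  also have "1 + ennreal (0 - F 1) < \<infinity>" by simp
  finally show ?thesis .
qed

lemma one_minus_cos_le: "1 - cos t \<le> min 2 ((t::real)\<^sup>2)"
proof -
  have "1 - cos t = 2 * (sin (t / 2))\<^sup>2" using cos_double_sin[of "t / 2"] by simp
  also have "(sin (t / 2))\<^sup>2 \<le> (t / 2)\<^sup>2"
    using abs_sin_x_le_abs_x[of "t / 2"] by (simp only: abs_le_square_iff)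
  finally have "2 * (1 - cos t) \<le> t\<^sup>2" by (simp add: power_divide)
  then have "1 - cos t \<le> t\<^sup>2 / 2" by simp
  also have "\<dots> \<le> t\<^sup>2" by simp
  finally have "1 - cos t \<le> t\<^sup>2" .
  then show ?thesis using cos_ge_minus_one[of t] by simp
qed

lemma cos_moment_finite:
  assumes "0 < p" "p < 1"
  shows "cos_moment p < \<infinity>"
proof -
  have "cos_moment p \<le> (\<integral>\<^sup>+t\<in>{0<..}. ennreal (min 2 (t\<^sup>2) * t powr (- p - 1)) \<partial>lborel)"
    unfolding cos_moment_def using one_minus_cos_le
    by (intro nn_integral_mono mult_right_mono ennreal_leI) auto
  then show ?thesis using nn_integral_powr_dominator[OF assms] by (rule le_less_trans)
qed

lemma cos_moment_pos: "0 < cos_moment p"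
proof (rule ccontr)
  assume "\<not> 0 < cos_moment p"
  then have "AE t in lborel. ennreal ((1 - cos t) * t powr (- p - 1)) * indicator {0<..} t = 0"
    unfolding cos_moment_def by (subst (asm) zero_less_iff_neq_zero, subst nn_integral_0_iff_AE[symmetric]) auto
  then have "AE t in lborel. t \<notin> {1<..<2::real}"
  proof (eventually_elim, safe)
    fix t :: real
    assume t: "ennreal ((1 - cos t) * t powr (- p - 1)) * indicator {0<..} t = 0" "t \<in> {1<..<2}"
    have "cos t < cos 0" using t(2) pi_gt3 by (intro cos_monotone_0_pi) auto
    then have "0 < (1 - cos t) * t powr (- p - 1)" using t(2) by (intro mult_pos_pos) auto
    with t show False by (simp add: ennreal_eq_0_iff)
  qed
  then have "emeasure lborel {1<..<2::real} = 0"
    by (subst (asm) AE_iff_measurable[where N = "{1<..<2}"]) auto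
  then show False by simp
qed

lemma nn_integral_cos_powr:
  fixes x p :: real
  assumes "0 < p"
  shows "(\<integral>\<^sup>+t\<in>{0<..}. ennreal ((1 - cos (t * x)) * t powr (- p - 1)) \<partial>lborel)
    = ennreal (\<bar>x\<bar> powr p) * cos_moment p"
proof (cases "x = 0")
  case False
  have "cos (t * x) = cos (\<bar>x\<bar> * t)" for t
    by (cases "0 \<le> x") (auto simp: mult.commute abs_if)
  then show ?thesis
    using False nn_integral_powr_scale[of "\<lambda>t. 1 - cos t" "\<bar>x\<bar>" p] by (simp add: cos_moment_def)
qed simp

text \<open>For a fixed real x, rescaling t by |x| pulls |x|^p out of the integral. Applied to each
  value of \<open>X\<close>, this leaves only an exchange of two nonnegative integrals.\<close>

lemma (in prob_space) nn_integral_abs_powr_cos: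
  fixes p :: real
  assumes [measurable]: "X \<in> borel_measurable M" and p: "0 < p"
  shows "(\<integral>\<^sup>+\<omega>. ennreal (\<bar>X \<omega>\<bar> powr p) \<partial>M) * cos_moment p
    = (\<integral>\<^sup>+t\<in>{0<..}. ennreal ((1 - (\<integral>\<omega>. cos (t * X \<omega>) \<partial>M)) * t powr (- p - 1)) \<partial>lborel)"
proof -
  interpret pair_sigma_finite M lborel ..
  have "(\<integral>\<^sup>+\<omega>. ennreal (\<bar>X \<omega>\<bar> powr p) \<partial>M) * cos_moment p = (\<integral>\<^sup>+\<omega>. ennreal (\<bar>X \<omega>\<bar> powr p) * cos_moment p \<partial>M)"
    by (subst nn_integral_multc) auto
  also have "\<dots> = (\<integral>\<^sup>+\<omega>. (\<integral>\<^sup>+t\<in>{0<..}. ennreal ((1 - cos (t * X \<omega>)) * t powr (- p - 1)) \<partial>lborel) \<partial>M)"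
    by (simp add: nn_integral_cos_powr[OF p])
  also have "\<dots> = (\<integral>\<^sup>+t. (\<integral>\<^sup>+\<omega>. ennreal ((1 - cos (t * X \<omega>)) * t powr (- p - 1)) * indicator {0<..} t \<partial>M) \<partial>lborel)"
    by (rule Fubini'[symmetric]) measurable
  also have "\<dots> = (\<integral>\<^sup>+t\<in>{0<..}. ennreal ((1 - (\<integral>\<omega>. cos (t * X \<omega>) \<partial>M)) * t powr (- p - 1)) \<partial>lborel)"
  proof (intro nn_integral_cong)
    fix t :: real
    have int: "integrable M (\<lambda>\<omega>. cos (t * X \<omega>))"
      by (rule integrable_const_bound[where B = 1]) auto
    have "(\<integral>\<^sup>+\<omega>. ennreal ((1 - cos (t * X \<omega>)) * t powr (- p - 1)) * indicator {0<..} t \<partial>M)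
      = (\<integral>\<^sup>+\<omega>. ennreal ((1 - cos (t * X \<omega>)) * t powr (- p - 1)) \<partial>M) * indicator {0<..} t"
      by (rule nn_integral_multc) measurable
    also have "(\<integral>\<^sup>+\<omega>. ennreal ((1 - cos (t * X \<omega>)) * t powr (- p - 1)) \<partial>M)
      = ennreal (\<integral>\<omega>. (1 - cos (t * X \<omega>)) * t powr (- p - 1) \<partial>M)"
      using int by (intro nn_integral_eq_integral) auto
    also have "(\<integral>\<omega>. (1 - cos (t * X \<omega>)) * t powr (- p - 1) \<partial>M) = (1 - (\<integral>\<omega>. cos (t * X \<omega>) \<partial>M)) * t powr (- p - 1)"
      using int by (simp add: prob_space)
    finally show "(\<integral>\<^sup>+\<omega>. ennreal ((1 - cos (t * X \<omega>)) * t powr (- p - 1)) * indicator {0<..} t \<partial>M)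
      = ennreal ((1 - (\<integral>\<omega>. cos (t * X \<omega>) \<partial>M)) * t powr (- p - 1)) * indicator {0<..} t" .
  qed
  finally show ?thesis .
qed


section \<open>Cosine transforms of uniform sums and of the normal law\<close>

lemma (in prob_space) expectation_cos_eq_char:
  assumes [measurable]: "X \<in> borel_measurable M"
  shows "(\<integral>\<omega>. cos (t * X \<omega>) \<partial>M) = Re (char (distr M borel X) t)"
proof -
  have "char (distr M borel X) t = (CLINT \<omega>|M. iexp (t * X \<omega>))"
    by (simp add: char_def integral_distr)
  moreover have "integrable M (\<lambda>\<omega>. iexp (t * X \<omega>))"
    by (intro integrable_iexp) auto
  ultimately have "Re (char (distr M borel X) t) = (\<integral>\<omega>. Re (iexp (t * X \<omega>)) \<partial>M)"
    by simp
  then show ?thesis by (simp add: Re_exp)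
qed

lemma (in prob_space) char_scaled_uniform:
  assumes "distributed M lborel U (\<lambda>x. indicator {-1..1} x / measure lborel {-1..1::real})"
  shows "char (distr M borel (\<lambda>\<omega>. a * U \<omega>)) t = complex_of_real (sinc (a * t))"
proof -
  have [measurable]: "U \<in> borel_measurable M" using distributed_measurable[OF assms] by simp
  have D: "distr M lborel U = density lborel (\<lambda>x. ennreal (indicator {-1..1} x / 2))"
    using distributed_distr_eq_density[OF assms] by simp
  define b where "b = a * t"
  have "char (distr M borel (\<lambda>\<omega>. a * U \<omega>)) t = (CLINT \<omega>|M. iexp (b * U \<omega>))"
    by (simp add: char_def integral_distr b_def mult_ac)
  also have "\<dots> = (CLINT x|distr M lborel U. iexp (b * x))"
    by (subst integral_distr) auto
  also have "\<dots> = (CLINT x|lborel. (indicator {-1..1} x / 2) *\<^sub>R iexp (b * x))"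
    unfolding D by (subst integral_density) auto
  also have "\<dots> = (CLINT x|lborel. indicator {-1..1} x *\<^sub>R (iexp (b * x) / 2))"
    by (intro Bochner_Integration.integral_cong) (auto simp: indicator_def scaleR_conv_of_real)
  also have "\<dots> = complex_of_real (sinc b)"
  proof (cases "b = 0")
    case True
    then show ?thesis by (simp add: scaleR_conv_of_real)
  next
    case False
    define F where "F = (\<lambda>x::real. iexp (b * x) / (2 * \<i> * b))"
    have "(CLINT x|lborel. indicator {-1..1} x *\<^sub>R (iexp (b * x) / 2)) = F 1 - F (-1)"
    proof (rule integral_FTC_Icc)
      show "(F has_vector_derivative iexp (b * x) / 2) (at x within {-1..1})" for x :: real
      proof -
        have "((\<lambda>x. exp (x *\<^sub>R (\<i> * b)) / (2 * \<i> * b)) has_vector_derivative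
            exp (x *\<^sub>R (\<i> * b)) * (\<i> * b) / (2 * \<i> * b)) (at x within {-1..1})"
          by (intro has_vector_derivative_divide exp_scaleR_has_vector_derivative_right)
        then show ?thesis using False by (simp add: F_def scaleR_conv_of_real mult_ac)
      qed
      show "continuous_on {-1..1} (\<lambda>x::real. iexp (b * x) / 2)"
        by (intro continuous_intros) auto
    qed auto
    also have "\<dots> = complex_of_real (sin b / b)"
      using False by (simp add: F_def complex_eq_iff Re_exp Im_exp Re_divide Im_divide field_simps power2_eq_square)
    finally show ?thesis using False by simp
  qed
  finally show ?thesis by (simp add: b_def)
qed

lemma (in prob_space) expectation_cos_uniform_sum:
  assumes indep: "indep_vars (\<lambda>_. borel) U I" and I: "finite I"
    and U: "\<And>j. j \<in> I \<Longrightarrow> distributed M lborel (U j) (\<lambda>x. indicator {-1..1} x / measure lborel {-1..1::real})"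
  shows "(\<integral>\<omega>. cos (t * (\<Sum>j\<in>I. a j * U j \<omega>)) \<partial>M) = (\<Prod>j\<in>I. sinc (a j * t))"
proof -
  have m: "U j \<in> borel_measurable M" if "j \<in> I" for j
    using distributed_measurable[OF U[OF that]] by simp
  have "indep_vars (\<lambda>_. borel) (\<lambda>j \<omega>. a j * U j \<omega>) I"
    using indep by (rule indep_vars_compose2) auto
  then have "char (distr M borel (\<lambda>\<omega>. \<Sum>j\<in>I. a j * U j \<omega>)) t
    = (\<Prod>j\<in>I. char (distr M borel (\<lambda>\<omega>. a j * U j \<omega>)) t)"
    by (rule char_distr_sum)
  also have "\<dots> = (\<Prod>j\<in>I. complex_of_real (sinc (a j * t)))"
    using U by (intro prod.cong char_scaled_uniform) auto
  also have "\<dots> = complex_of_real (\<Prod>j\<in>I. sinc (a j * t))" by (simp only: of_real_prod)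
  finally show ?thesis
    using m by (subst expectation_cos_eq_char) (auto simp del: of_real_prod)
qed

lemma (in prob_space) expectation_cos_std_normal:
  assumes "distributed M lborel Z std_normal_density"
  shows "(\<integral>\<omega>. cos (t * Z \<omega>) \<partial>M) = exp (- t\<^sup>2 / 2)"
proof -
  have [measurable]: "Z \<in> borel_measurable M" using distributed_measurable[OF assms] by simp
  have "distr M borel Z = distr M lborel Z" by (rule distr_cong) auto
  then have "distr M borel Z = std_normal_distribution"
    using distributed_distr_eq_density[OF assms] by simp
  then show ?thesis by (simp add: expectation_cos_eq_char char_std_normal_distribution)
qed

subsection \<open>Small coefficients\<close>

text \<open>Convexity of exp at the points ln (x_j) / w_j. The exponents 1 / w_j become the powers
  of sinc when w_j = a_j^2.\<close>

lemma weighted_am_gm: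
  fixes x w :: "'i \<Rightarrow> real"
  assumes I: "finite I" and w: "\<And>j. j \<in> I \<Longrightarrow> 0 < w j" "(\<Sum>j\<in>I. w j) = 1" and x: "\<And>j. j \<in> I \<Longrightarrow> 0 \<le> x j"
  shows "(\<Prod>j\<in>I. x j) \<le> (\<Sum>j\<in>I. w j * x j powr (1 / w j))"
proof (cases "\<exists>j\<in>I. x j = 0")
  case True
  then have "(\<Prod>j\<in>I. x j) = 0" using I by (simp add: prod_zero_iff)
  also have "0 \<le> (\<Sum>j\<in>I. w j * x j powr (1 / w j))"
    using w by (intro sum_nonneg mult_nonneg_nonneg) (auto intro: less_imp_le)
  finally show ?thesis .
next
  case False
  have "(\<Prod>j\<in>I. x j) = (\<Prod>j\<in>I. exp (ln (x j)))"
    using False x by (intro prod.cong) (auto simp: less_le)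
  also have "\<dots> = exp (\<Sum>j\<in>I. w j *\<^sub>R (ln (x j) / w j))"
    using w(1) I by (simp add: exp_sum less_imp_neq[THEN not_sym] cong: prod.cong)
  also have "\<dots> \<le> (\<Sum>j\<in>I. w j * exp (ln (x j) / w j))"
    using I w by (intro convex_on_sum[OF _ _ exp_convex]) (auto intro: less_imp_le)
  also have "\<dots> = (\<Sum>j\<in>I. w j * x j powr (1 / w j))"
    using False by (intro sum.cong) (auto simp: powr_def)
  finally show ?thesis .
qed

text \<open>The Fourier side of E |G|^p, as exp (- t^2 / 6) is the characteristic function of
  G.\<close>

definition gauss_cos_integral :: "real \<Rightarrow> ennreal" where
  "gauss_cos_integral p = (\<integral>\<^sup>+t\<in>{0<..}. ennreal ((1 - exp (- (t\<^sup>2 / 6))) * t powr (- p - 1)) \<partial>lborel)"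

lemma (in prob_space) gauss_cos_integral_eq:
  assumes Z: "distributed M lborel Z std_normal_density" and p: "0 < p"
  shows "(\<integral>\<^sup>+\<omega>. ennreal (\<bar>Z \<omega> / sqrt 3\<bar> powr p) \<partial>M) * cos_moment p = gauss_cos_integral p"
proof -
  have [measurable]: "Z \<in> borel_measurable M" using distributed_measurable[OF Z] by simp
  have "(\<integral>\<omega>. cos (t * (Z \<omega> / sqrt 3)) \<partial>M) = exp (- (t\<^sup>2 / 6))" for t
    using expectation_cos_std_normal[OF Z, of "t / sqrt 3"] by (simp add: power_divide)
  then show ?thesis
    using nn_integral_abs_powr_cos[of "\<lambda>\<omega>. Z \<omega> / sqrt 3" p] p by (simp add: gauss_cos_integral_def)
qed

text \<open>With s = 1 / a_j^2 the rescaling of t by |a_j| turns exp (- s t^2 / 6) into exp (- t^2 /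
  6). So every term is compared with the same Gaussian integral, and the weights a_j^2 put these
  together to exactly one copy.\<close>

lemma (in prob_space) gauss_cos_integral_le_small_coefficients:
  fixes a :: "'i \<Rightarrow> real"
  assumes indep: "indep_vars (\<lambda>_. borel) U I" and I: "finite I"
    and U: "\<And>j. j \<in> I \<Longrightarrow> distributed M lborel (U j) (\<lambda>x. indicator {-1..1} x / measure lborel {-1..1::real})"
    and a: "(\<Sum>j\<in>I. (a j)\<^sup>2) = 1" "\<And>j. j \<in> I \<Longrightarrow> (a j)\<^sup>2 \<le> 25/43" and p: "0 < p"
  shows "gauss_cos_integral p \<le> (\<integral>\<^sup>+\<omega>. ennreal (\<bar>\<Sum>j\<in>I. a j * U j \<omega>\<bar> powr p) \<partial>M) * cos_moment p"
proof -
  have m: "U j \<in> borel_measurable M" if "j \<in> I" for j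
    using distributed_measurable[OF U[OF that]] by simp
  \<comment> \<open>Zero coefficients would give weight 0 and no exponent 1 / a_j^2; dropping them
    leaves the product unchanged because sinc is 1 at 0.\<close>
  define J where "J = {j\<in>I. a j \<noteq> 0}"
  have J: "finite J" "\<And>j. j \<in> J \<Longrightarrow> a j \<noteq> 0" "J \<subseteq> I" using I by (auto simp: J_def)
  have sumJ: "(\<Sum>j\<in>J. (a j)\<^sup>2) = 1"
    using a(1) I by (subst sum.mono_neutral_left[of I]) (auto simp: J_def)
  define f where "f = (\<lambda>j t. 1 - \<bar>sin t / t\<bar> powr (1 / (a j)\<^sup>2))"
  have [measurable]: "f j \<in> borel_measurable borel" for j unfolding f_def by measurable
  have f0: "0 \<le> f j t" for j t
    using sinc_le_one[of t] powr_mono2[of "1 / (a j)\<^sup>2" "\<bar>sin t / t\<bar>" 1] by (auto simp: f_def)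
  have term_ge: "gauss_cos_integral p \<le> (\<integral>\<^sup>+t\<in>{0<..}. ennreal (f j (\<bar>a j\<bar> * t) * t powr (- p - 1)) \<partial>lborel)"
    if j: "j \<in> J" for j
  proof -
    have s: "43/25 \<le> 1 / (a j)\<^sup>2" using a(2)[of j] J(2)[of j] J(3) j by (auto simp: field_simps)
    have aj: "0 < \<bar>a j\<bar>" using J(2) j by simp
    have "gauss_cos_integral p = (\<integral>\<^sup>+t\<in>{0<..}. ennreal ((1 - exp (- (1 / (a j)\<^sup>2 * (\<bar>a j\<bar> * t)\<^sup>2 / 6))) * t powr (- p - 1)) \<partial>lborel)"
      using aj by (simp add: gauss_cos_integral_def power_mult_distrib)
    also have "\<dots> = ennreal (\<bar>a j\<bar> powr p) * (\<integral>\<^sup>+t\<in>{0<..}. ennreal ((1 - exp (- (1 / (a j)\<^sup>2 * t\<^sup>2 / 6))) * t powr (- p - 1)) \<partial>lborel)"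
      by (intro nn_integral_powr_scale aj) measurable
    also have "\<dots> \<le> ennreal (\<bar>a j\<bar> powr p) * (\<integral>\<^sup>+t\<in>{0<..}. ennreal (f j t * t powr (- p - 1)) \<partial>lborel)"
      unfolding f_def by (intro mult_left_mono set_nn_integral_sinc_gauss s p) auto
    also have "\<dots> = (\<integral>\<^sup>+t\<in>{0<..}. ennreal (f j (\<bar>a j\<bar> * t) * t powr (- p - 1)) \<partial>lborel)"
      by (intro nn_integral_powr_scale[symmetric] aj) measurable
    finally show ?thesis .
  qed
  have pointwise: "(\<Sum>j\<in>J. (a j)\<^sup>2 * f j (\<bar>a j\<bar> * t)) \<le> 1 - (\<Prod>j\<in>I. sinc (a j * t))" if t: "0 < t" for t
  proof -
    have "(\<Prod>j\<in>I. sinc (a j * t)) = (\<Prod>j\<in>J. sinc (a j * t))"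
      using I by (intro prod.mono_neutral_right) (auto simp: J_def)
    \<comment> \<open>AM-GM needs nonnegative factors, so the signs of the sinc factors are given up
      here.\<close>
    also have "\<dots> \<le> (\<Prod>j\<in>J. \<bar>sin (\<bar>a j\<bar> * t) / (\<bar>a j\<bar> * t)\<bar>)"
    proof -
      have "\<bar>\<Prod>j\<in>J. sinc (a j * t)\<bar> = (\<Prod>j\<in>J. \<bar>sin (\<bar>a j\<bar> * t) / (\<bar>a j\<bar> * t)\<bar>)"
        unfolding abs_prod using J(2) t by (intro prod.cong) (auto simp: abs_if)
      then show ?thesis by linarith
    qed
    also have "\<dots> \<le> (\<Sum>j\<in>J. (a j)\<^sup>2 * \<bar>sin (\<bar>a j\<bar> * t) / (\<bar>a j\<bar> * t)\<bar> powr (1 / (a j)\<^sup>2))"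
      using J sumJ by (intro weighted_am_gm) auto
    also have "\<dots> = (\<Sum>j\<in>J. (a j)\<^sup>2) - (\<Sum>j\<in>J. (a j)\<^sup>2 * f j (\<bar>a j\<bar> * t))"
      by (simp add: f_def algebra_simps flip: sum_subtractf)
    finally show ?thesis using sumJ by simp
  qed
  have "gauss_cos_integral p = ennreal (\<Sum>j\<in>J. (a j)\<^sup>2) * gauss_cos_integral p" by (simp add: sumJ)
  also have "\<dots> = (\<Sum>j\<in>J. ennreal ((a j)\<^sup>2) * gauss_cos_integral p)"
    by (simp add: sum_distrib_right flip: sum_ennreal)
  also have "\<dots> \<le> (\<Sum>j\<in>J. ennreal ((a j)\<^sup>2) * (\<integral>\<^sup>+t\<in>{0<..}. ennreal (f j (\<bar>a j\<bar> * t) * t powr (- p - 1)) \<partial>lborel))"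
    by (intro sum_mono mult_left_mono term_ge) auto
  also have "\<dots> = (\<integral>\<^sup>+t. (\<Sum>j\<in>J. ennreal ((a j)\<^sup>2) * (ennreal (f j (\<bar>a j\<bar> * t) * t powr (- p - 1)) * indicator {0<..} t)) \<partial>lborel)"
    by (simp add: nn_integral_sum nn_integral_cmult)
  also have "\<dots> \<le> (\<integral>\<^sup>+t\<in>{0<..}. ennreal ((1 - (\<Prod>j\<in>I. sinc (a j * t))) * t powr (- p - 1)) \<partial>lborel)"
  proof (intro nn_integral_mono)
    fix t :: real
    show "(\<Sum>j\<in>J. ennreal ((a j)\<^sup>2) * (ennreal (f j (\<bar>a j\<bar> * t) * t powr (- p - 1)) * indicator {0<..} t))
      \<le> ennreal ((1 - (\<Prod>j\<in>I. sinc (a j * t))) * t powr (- p - 1)) * indicator {0<..} t"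
    proof (cases "0 < t")
      case True
      have "(\<Sum>j\<in>J. ennreal ((a j)\<^sup>2) * (ennreal (f j (\<bar>a j\<bar> * t) * t powr (- p - 1))))
        = (\<Sum>j\<in>J. ennreal ((a j)\<^sup>2 * f j (\<bar>a j\<bar> * t) * t powr (- p - 1)))"
        by (simp add: ennreal_mult' mult.assoc)
      also have "\<dots> = ennreal ((\<Sum>j\<in>J. (a j)\<^sup>2 * f j (\<bar>a j\<bar> * t)) * t powr (- p - 1))"
        using f0 by (subst sum_ennreal) (auto simp: sum_distrib_right)
      also have "\<dots> \<le> ennreal ((1 - (\<Prod>j\<in>I. sinc (a j * t))) * t powr (- p - 1))"
        using pointwise[OF True] by (intro ennreal_leI mult_right_mono) auto
      finally show ?thesis using True by simp
    qed simp
  qed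
  also have "\<dots> = (\<integral>\<^sup>+\<omega>. ennreal (\<bar>\<Sum>j\<in>I. a j * U j \<omega>\<bar> powr p) \<partial>M) * cos_moment p"
    using m by (subst nn_integral_abs_powr_cos[OF _ p]) (auto simp: expectation_cos_uniform_sum[OF indep I U])
  finally show ?thesis .
qed

text \<open>A crude form of 1 - x^2/6, sufficient for a majorant that is uniform in the number of
  summands.\<close>

lemma sinc_ge: "\<bar>x\<bar> \<le> 1 \<Longrightarrow> 1 - x\<^sup>2 \<le> sinc x"
proof -
  have pos: "1 - x\<^sup>2 \<le> sin x / x" if x: "0 < x" for x :: real
  proof -
    define f where "f = (\<lambda>x::real. sin x - x + x ^ 3)"
    have "f 0 \<le> f x"
    proof (rule DERIV_nonneg_imp_nondecreasing[OF less_imp_le[OF x]])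
      fix y :: real
      have "(f has_real_derivative cos y - 1 + 3 * y\<^sup>2) (at y)"
        unfolding f_def by (auto intro!: derivative_eq_intros)
      moreover have "0 \<le> cos y - 1 + 3 * y\<^sup>2"
        using one_minus_cos_le[of y] zero_le_power2[of y] by linarith
      ultimately show "\<exists>d. (f has_real_derivative d) (at y) \<and> 0 \<le> d" by blast
    qed
    then show ?thesis using x by (simp add: f_def field_simps power2_eq_square power3_eq_cube)
  qed
  show "1 - x\<^sup>2 \<le> sinc x"
    using pos[of x] pos[of "- x"] by (cases x "0 :: real" rule: linorder_cases) auto
qed

lemma tendsto_sinc_power:
  fixes t :: real
  assumes t: "0 < t"
  shows "(\<lambda>n. (sin (t / sqrt (real n)) / (t / sqrt (real n))) ^ n) \<longlonglongrightarrow> exp (- (t\<^sup>2 / 6))"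
proof -
  \<comment> \<open>The unsimplified exponent is the form in which \<open>real_asymp\<close> is
    given the limit; it is reduced to \<open>t\<^sup>2 / 6\<close> afterwards.\<close>
  have "(\<lambda>n. (sin (t / sqrt (real n)) / (t / sqrt (real n))) ^ n)
      \<longlonglongrightarrow> exp (- (inverse t * t * (t * (t * t) * inverse t) / 6))"
    using t by real_asymp
  also have "inverse t * t * (t * (t * t) * inverse t) / 6 = t\<^sup>2 / 6"
    using t by (simp add: field_simps power2_eq_square)
  finally show ?thesis .
qed

subsection \<open>Fractional moments of a shifted uniform variable\<close>

text \<open>The odd function v |v|^q is, up to the factor q + 1, an antiderivative of |v|^q on the
  whole line. At 0 its difference quotient is |h|^q, which tends to 0.\<close>

lemma has_real_derivative_mult_abs_powr:
  fixes v q :: real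
  assumes q: "0 < q"
  shows "((\<lambda>v. v * \<bar>v\<bar> powr q) has_real_derivative (q + 1) * \<bar>v\<bar> powr q) (at v)"
proof -
  consider "v < 0" | "v = 0" | "0 < v" by linarith
  then show ?thesis
  proof cases
    case 1
    have "((\<lambda>v. v * (- v) powr q) has_real_derivative (q + 1) * (- v) powr q) (at v)"
      using 1 by (auto intro!: derivative_eq_intros simp: powr_diff field_simps)
    then show ?thesis
      using 1 by (subst DERIV_cong_ev[OF refl _ refl, of _ "\<lambda>v. v * (- v) powr q"])
        (auto intro: eventually_mono[OF eventually_nhds_in_open[of "{..<0}" v]])
  next
    case 2
    have "((\<lambda>h. \<bar>h\<bar> powr q) \<longlongrightarrow> \<bar>0\<bar> powr q) (at (0::real))"
      using q by (intro tendsto_powr' tendsto_intros) auto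
    then have "((\<lambda>h::real. \<bar>h\<bar> powr q) \<longlongrightarrow> 0) (at 0)" by simp
    then have "((\<lambda>h. (h * \<bar>h\<bar> powr q - 0) / (h - 0)) \<longlongrightarrow> 0) (at 0)"
      by (rule Lim_transform_eventually) (auto simp: eventually_at_filter)
    then show ?thesis using 2 by (simp add: has_field_derivative_iff)
  next
    case 3
    have "((\<lambda>v. v * v powr q) has_real_derivative (q + 1) * v powr q) (at v)"
      using 3 by (auto intro!: derivative_eq_intros simp: powr_diff field_simps)
    then show ?thesis
      using 3 by (subst DERIV_cong_ev[OF refl _ refl, of _ "\<lambda>v. v * v powr q"])
        (auto intro: eventually_mono[OF eventually_nhds_in_open[of "{0<..}" v]])
  qed
qed

text \<open>This is \<open>(1 + p) E \<bar>x + U\<bar>\<^sup>p\<close> for \<open>U\<close> uniform on \<open>[-1, 1]\<close>.\<close>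

definition uniform_moment :: "real \<Rightarrow> real \<Rightarrow> real" where
  "uniform_moment p x = ((x + 1) * \<bar>x + 1\<bar> powr p - (x - 1) * \<bar>x - 1\<bar> powr p) / 2"

lemma uniform_moment_minus: "uniform_moment p (- x) = uniform_moment p x"
proof -
  have "\<bar>- x + 1\<bar> = \<bar>x - 1\<bar>" "\<bar>- x - 1\<bar> = \<bar>x + 1\<bar>" by auto
  then show ?thesis by (simp add: uniform_moment_def algebra_simps)
qed

lemma has_real_derivative_uniform_moment:
  assumes "0 < p"
  shows "(uniform_moment p has_real_derivative (p + 1) / 2 * (\<bar>x + 1\<bar> powr p - \<bar>x - 1\<bar> powr p)) (at x)"
proof -
  have "((\<lambda>x. (x + c) * \<bar>x + c\<bar> powr p) has_real_derivative (p + 1) * \<bar>x + c\<bar> powr p * 1) (at x)" for c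
    by (rule DERIV_chain2[OF has_real_derivative_mult_abs_powr[OF assms]]) (auto intro!: derivative_eq_intros)
  from DERIV_cdivide[OF DERIV_diff[OF this[of 1] this[of "-1"]], of 2]
  show ?thesis unfolding uniform_moment_def [abs_def] by (simp add: algebra_simps diff_divide_distrib)
qed

text \<open>The derivative is p times (1 + y)^(p-1) + (1 - y)^(p-1). Tangent bounds for the two
  powers have opposite linear terms, so their sum is at least 2.\<close>

lemma powr_increment_ge:
  fixes x p :: real
  assumes x: "0 \<le> x" "x \<le> 1" and p: "0 < p" "p < 1"
  shows "2 * p * x \<le> (1 + x) powr p - (1 - x) powr p"
proof -
  define f where "f = (\<lambda>x::real. (1 + x) powr p - (1 - x) powr p - 2 * p * x)"
  have "f 0 \<le> f x"
  proof (rule DERIV_nonneg_imp_increasing_open[OF x(1)])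
    fix y :: real assume y: "0 < y" "y < x"
    have "(f has_real_derivative p * (1 + y) powr (p - 1) + p * (1 - y) powr (p - 1) - 2 * p) (at y)"
      using y x unfolding f_def by (auto intro!: derivative_eq_intros)
    moreover have "1 + (p - 1) * y \<le> (1 + y) powr (p - 1)"
    proof -
      have "(1 - p) * ln (1 + y) \<le> (1 - p) * y"
        using p y ln_add_one_self_le_self[of y] by (intro mult_left_mono) auto
      then have "1 + (p - 1) * y \<le> 1 + (p - 1) * ln (1 + y)" by (simp add: algebra_simps)
      also have "\<dots> \<le> exp ((p - 1) * ln (1 + y))" by (rule exp_ge_add_one_self)
      finally show ?thesis using y by (simp add: powr_def)
    qed
    moreover have "1 - (p - 1) * y \<le> (1 - y) powr (p - 1)"
    proof -
      have "ln (1 - y) \<le> - y" using ln_le_minus_one[of "1 - y"] x y by simp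
      then have "(1 - p) * ln (1 - y) \<le> (1 - p) * - y"
        using p by (intro mult_left_mono) auto
      then have "1 - (p - 1) * y \<le> 1 + (p - 1) * ln (1 - y)" by (simp add: algebra_simps)
      also have "\<dots> \<le> exp ((p - 1) * ln (1 - y))" by (rule exp_ge_add_one_self)
      finally show ?thesis using y x by (simp add: powr_def)
    qed
    ultimately have "2 \<le> (1 + y) powr (p - 1) + (1 - y) powr (p - 1)" by linarith
    then have "p * 2 \<le> p * ((1 + y) powr (p - 1) + (1 - y) powr (p - 1))" using p by (intro mult_left_mono) auto
    then show "\<exists>d. (f has_real_derivative d) (at y) \<and> 0 \<le> d"
      using \<open>(f has_real_derivative _) (at y)\<close> by (intro exI conjI) (assumption, simp add: algebra_simps)
  next
    show "continuous_on {0..x} f"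
      unfolding f_def using p x by (intro continuous_intros continuous_on_powr') auto
  qed
  then show ?thesis by (simp add: f_def)
qed

text \<open>Increments of the concave function z^p over intervals of length 2 decrease. Hence
  \<open>uniform_moment p\<close> is concave to the right of 1.\<close>

lemma powr_increment_antimono:
  fixes x y p :: real
  assumes x: "1 \<le> x" "x \<le> y" and p: "0 < p" "p < 1"
  shows "(y + 1) powr p - (y - 1) powr p \<le> (x + 1) powr p - (x - 1) powr p"
proof -
  define f where "f = (\<lambda>x::real. (x - 1) powr p - (x + 1) powr p)"
  have "f x \<le> f y"
  proof (rule DERIV_nonneg_imp_increasing_open[OF x(2)])
    fix z :: real assume z: "x < z" "z < y"
    have "(f has_real_derivative p * (z - 1) powr (p - 1) - p * (z + 1) powr (p - 1)) (at z)"
      using z x unfolding f_def by (auto intro!: derivative_eq_intros)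
    moreover have "(z + 1) powr (p - 1) \<le> (z - 1) powr (p - 1)"
      using z x p by (intro powr_mono2') auto
    then have "0 \<le> p * (z - 1) powr (p - 1) - p * (z + 1) powr (p - 1)" using p by simp
    ultimately show "\<exists>d. (f has_real_derivative d) (at z) \<and> 0 \<le> d" by blast
  next
    show "continuous_on {x..y} f"
      unfolding f_def using p x by (intro continuous_intros continuous_on_powr') auto
  qed
  then show ?thesis by (simp add: f_def)
qed

text \<open>The Lagrange remainder has the even order 4, so the bound also holds for negative
  \<open>x\<close>, where it is mostly used to certify logarithms.\<close>

lemma exp_ge_cubic: "1 + x + x\<^sup>2 / 2 + x ^ 3 / 6 \<le> exp (x::real)"
proof -
  obtain t where "exp x = (\<Sum>m<4. x ^ m / fact m) + exp t / fact 4 * x ^ 4"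
    using Maclaurin_exp_le[of x 4] by auto
  moreover have "0 \<le> exp t / fact 4 * x ^ 4" by simp
  ultimately show ?thesis by (simp add: numeral_eq_Suc)
qed

text \<open>The second assumption certifies c <= ln b by rational arithmetic, since its right side
  is at most exp (-c); taking quarters of \<open>c\<close> keeps the cubic Taylor polynomial
  accurate.\<close>

lemma powr_ge_cubic:
  fixes b c p :: real
  assumes b: "0 < b" and c: "1 / b \<le> (1 - c / 4 + (c / 4)\<^sup>2 / 2 - (c / 4) ^ 3 / 6) ^ 4"
    "0 \<le> 1 - c / 4 + (c / 4)\<^sup>2 / 2 - (c / 4) ^ 3 / 6" and p: "0 \<le> p"
  shows "1 + c * p + c\<^sup>2 / 2 * p\<^sup>2 + c ^ 3 / 6 * p ^ 3 \<le> b powr p"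
proof -
  have "(1 - c / 4 + (c / 4)\<^sup>2 / 2 - (c / 4) ^ 3 / 6) ^ 4 \<le> exp (- c / 4) ^ 4"
    using exp_ge_cubic[of "- c / 4"] c by (intro power_mono) (auto simp: power_divide)
  also have "\<dots> = exp (- c)" by (simp flip: exp_of_nat_mult)
  finally have "1 / b \<le> exp (- c)" using c by simp
  then have "exp c \<le> b" using b by (simp add: exp_minus field_simps)
  then have "c \<le> ln b" using b by (simp add: ln_ge_iff)
  then have "p * c \<le> p * ln b" using p by (rule mult_left_mono)
  then have "exp (c * p) \<le> b powr p" using b by (simp add: powr_def mult.commute)
  with exp_ge_cubic[of "c * p"] show ?thesis by (simp add: power_mult_distrib)
qed

text \<open>The quadratic coefficient is the exact one at 0. The quartic correction is needed
  because the moment grows only like |x|^p; it keeps the minorant below while its expectation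
  involves no moments but the second and the fourth.\<close>

lemma uniform_moment_ge:
  fixes x p :: real
  assumes p: "0 < p" "p < 1"
  shows "1 + p * (1 + p) * (x\<^sup>2 / 2 - x ^ 4 / 20) \<le> uniform_moment p x"
proof -
  have pos: "0 \<le> p\<^sup>2" "0 \<le> p ^ 3" using p by auto
  \<comment> \<open>69/100 and, below, 109/100 are lower bounds for ln 2 and ln 3; the other
    coefficients are c^2/2 and c^3/6 rounded down.\<close>
  have two: "1 + 69/100 * p + 119/500 * p\<^sup>2 + 547/10000 * p ^ 3 \<le> 2 powr p"
    using powr_ge_cubic[of 2 "69/100" p] p
    by (simp add: power_divide) (use pos in linarith)
  have three: "1 + 109/100 * p + 297/500 * p\<^sup>2 + 1079/5000 * p ^ 3 \<le> 3 powr p"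
    using powr_ge_cubic[of 3 "109/100" p] p
    by (simp add: power_divide) (use pos in linarith)
  \<comment> \<open>This bounds p^3 below by 2 p^2 - p, so that the comparisons below become linear
    in p and p^2.\<close>
  have "0 \<le> p * (1 - p)\<^sup>2" using p by simp
  moreover have "p * (1 - p)\<^sup>2 = p ^ 3 - 2 * p\<^sup>2 + p"
    by (simp add: power2_eq_square power3_eq_cube algebra_simps)
  ultimately have p2: "p\<^sup>2 \<le> p" "0 \<le> p\<^sup>2" "2 * p\<^sup>2 - p \<le> p ^ 3"
    using p power_decreasing[of 1 2 p] by simp_all
  have pp: "p * (1 + p) * c = c * p + c * p\<^sup>2" for c by (simp add: power2_eq_square algebra_simps)
  have um0: "uniform_moment p 0 = 1" by (simp add: uniform_moment_def)
  have um1: "uniform_moment p 1 = 2 powr p" by (simp add: uniform_moment_def)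
  have um2: "uniform_moment p 2 = (3 * 3 powr p - 1) / 2" by (simp add: uniform_moment_def)
  have main: "1 + p * (1 + p) * (x\<^sup>2 / 2 - x ^ 4 / 20) \<le> uniform_moment p x" if x: "0 \<le> x" for x
  proof -
    consider "x \<le> 1" | "1 \<le> x" "x \<le> 2" | "2 \<le> x" by linarith
    then show ?thesis
    proof cases
      case 1
      define f where "f = (\<lambda>x. uniform_moment p x - p * (1 + p) * (x\<^sup>2 / 2))"
      have "f 0 \<le> f x"
      proof (rule DERIV_nonneg_imp_nondecreasing[OF x])
        fix y assume y: "0 \<le> y" "y \<le> x"
        have "(f has_real_derivative (p + 1) / 2 * (\<bar>y + 1\<bar> powr p - \<bar>y - 1\<bar> powr p) - p * (1 + p) * y) (at y)"
          unfolding f_def by (auto intro!: derivative_eq_intros has_real_derivative_uniform_moment p)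
        moreover have "(p + 1) / 2 * (2 * p * y) \<le> (p + 1) / 2 * (\<bar>y + 1\<bar> powr p - \<bar>y - 1\<bar> powr p)"
          using powr_increment_ge[of y p] y 1 p by (intro mult_left_mono) (auto simp: add.commute abs_minus_commute)
        moreover have "(p + 1) / 2 * (2 * p * y) = p * (1 + p) * y" by (simp add: algebra_simps)
        ultimately have "0 \<le> (p + 1) / 2 * (\<bar>y + 1\<bar> powr p - \<bar>y - 1\<bar> powr p) - p * (1 + p) * y"
          by linarith
        with \<open>(f has_real_derivative _) (at y)\<close> show "\<exists>d. (f has_real_derivative d) (at y) \<and> 0 \<le> d" by blast
      qed
      then have "1 + p * (1 + p) * (x\<^sup>2 / 2) \<le> uniform_moment p x"
        by (simp add: f_def um0)
      moreover have "p * (1 + p) * (x\<^sup>2 / 2 - x ^ 4 / 20) \<le> p * (1 + p) * (x\<^sup>2 / 2)"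
        using p by (intro mult_left_mono) auto
      ultimately show ?thesis by linarith
    next
      case 2
      \<comment> \<open>By concavity the moment lies above its chord on [1,2], so lower bounds at
        the two ends are enough.\<close>
      have "convex_on {1..2} (\<lambda>x. - uniform_moment p x)"
      proof (rule convex_on_realI)
        fix y z :: real assume "y \<in> {1..2}" "z \<in> {1..2}" "y \<le> z"
        then show "- ((p + 1) / 2 * (\<bar>y + 1\<bar> powr p - \<bar>y - 1\<bar> powr p)) \<le> - ((p + 1) / 2 * (\<bar>z + 1\<bar> powr p - \<bar>z - 1\<bar> powr p))"
          using powr_increment_antimono[of y z p] p by auto
      qed (auto intro!: derivative_eq_intros has_real_derivative_uniform_moment p)
      from convex_onD[OF this, of "x - 1" 1 2] 2
      have chord: "(2 - x) * 2 powr p + (x - 1) * ((3 * 3 powr p - 1) / 2) \<le> uniform_moment p x"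
        by (simp add: um1 um2 algebra_simps)
      have "1 + p * (1 + p) * (49/100) \<le> 2 powr p"
        unfolding pp using two p p2 by argo
      then have "(2 - x) * (1 + p * (1 + p) * (49/100)) \<le> (2 - x) * 2 powr p"
        using 2 by (intro mult_left_mono) auto
      moreover have "1 + p * (1 + p) * (129/100) \<le> (3 * 3 powr p - 1) / 2"
        unfolding pp using three p p2 by argo
      then have "(x - 1) * (1 + p * (1 + p) * (129/100)) \<le> (x - 1) * ((3 * 3 powr p - 1) / 2)"
        using 2 by (intro mult_left_mono) auto
      moreover have "p * (1 + p) * (x\<^sup>2 / 2 - x ^ 4 / 20) \<le> p * (1 + p) * (49/100 + 4/5 * (x - 1))"
      proof (intro mult_left_mono)
        show "x\<^sup>2 / 2 - x ^ 4 / 20 \<le> 49/100 + 4/5 * (x - 1)"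
        proof -
          define d where "d = x - 1"
          have d: "0 \<le> d" "x = d + 1" using 2 by (auto simp: d_def)
          \<comment> \<open>The slope 4/5 of the line is that of the quartic at 1, so only terms of
            degree at least 2 in \<open>d\<close> remain; d^2 - d^3 has its maximum 4/27 at
            2/3.\<close>
          have "0 \<le> (d - 2 / 3)\<^sup>2 * (d + 1 / 3)" "0 \<le> d ^ 4" using d by auto
          moreover have "(d - 2 / 3)\<^sup>2 * (d + 1 / 3) = d ^ 3 - d\<^sup>2 + 4 / 27"
            by (simp add: power2_eq_square power3_eq_cube field_simps)
          moreover have "(d + 1)\<^sup>2 = d\<^sup>2 + 2 * d + 1" "(d + 1) ^ 4 = d ^ 4 + 4 * d ^ 3 + 6 * d\<^sup>2 + 4 * d + 1"
            by (simp_all add: power2_eq_square power3_eq_cube power4_eq_xxxx algebra_simps)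
          ultimately show ?thesis unfolding d(2) by argo
        qed
      qed (use p in auto)
      moreover have "(2 - x) * (1 + p * (1 + p) * (49/100)) + (x - 1) * (1 + p * (1 + p) * (129/100))
        = 1 + p * (1 + p) * (49/100 + 4/5 * (x - 1))" by (simp add: field_simps)
      ultimately show ?thesis using chord by linarith
    next
      case 3
      \<comment> \<open>From here on the moment increases, while the minorant never exceeds 1 + p (1
        + p) 5/4, attained at x^2 = 5.\<close>
      have "uniform_moment p 2 \<le> uniform_moment p x"
      proof (rule DERIV_nonneg_imp_nondecreasing[OF 3])
        fix y :: real assume y: "2 \<le> y" "y \<le> x"
        have "0 \<le> (p + 1) / 2 * (\<bar>y + 1\<bar> powr p - \<bar>y - 1\<bar> powr p)"
          using y p by (auto intro!: mult_nonneg_nonneg powr_mono2)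
        then show "\<exists>d. (uniform_moment p has_real_derivative d) (at y) \<and> 0 \<le> d"
          using has_real_derivative_uniform_moment[OF p(1)] by blast
      qed
      moreover have "1 + p * (1 + p) * (5/4) \<le> (3 * 3 powr p - 1) / 2"
        unfolding pp using three p p2 by argo
      moreover have "p * (1 + p) * (x\<^sup>2 / 2 - x ^ 4 / 20) \<le> p * (1 + p) * (5/4)"
      proof (intro mult_left_mono)
        have "0 \<le> (x\<^sup>2 - 5)\<^sup>2 / 20" by simp
        then show "x\<^sup>2 / 2 - x ^ 4 / 20 \<le> 5/4" by (simp add: power2_eq_square numeral_eq_Suc algebra_simps)
      qed (use p in auto)
      ultimately show ?thesis by (simp add: um2)
    qed
  qed
  show ?thesis
  proof (cases "0 \<le> x")
    case False
    then show ?thesis using main[of "- x"] uniform_moment_minus[of p x] by simp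
  qed (rule main)
qed

subsection \<open>Fractional moments of the normal distribution\<close>

definition normal_abs_moment :: "real \<Rightarrow> real" where
  "normal_abs_moment q = (\<integral>x. std_normal_density x * \<bar>x\<bar> powr q \<partial>lborel)"

lemma integrable_normal_abs_powr:
  assumes "0 < q"
  shows "integrable lborel (\<lambda>x. std_normal_density x * \<bar>x\<bar> powr q)"
proof -
  define n where "n = nat \<lceil>q\<rceil>"
  have n: "q \<le> real n" unfolding n_def by linarith
  show ?thesis
  proof (rule Bochner_Integration.integrable_bound)
    show "integrable lborel (\<lambda>x. std_normal_density x * \<bar>x\<bar> ^ 0 + std_normal_density x * \<bar>x\<bar> ^ n)"
      by (intro Bochner_Integration.integrable_add integrable_std_normal_moment_abs)
    show "AE x in lborel. norm (std_normal_density x * \<bar>x\<bar> powr q)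
      \<le> norm (std_normal_density x * \<bar>x\<bar> ^ 0 + std_normal_density x * \<bar>x\<bar> ^ n)"
    proof (intro AE_I2)
      fix x :: real
      have "\<bar>x\<bar> powr q \<le> 1 + \<bar>x\<bar> ^ n"
      proof (cases "\<bar>x\<bar> \<le> 1")
        case True
        then have "\<bar>x\<bar> powr q \<le> 1" using assms by (intro powr_le1) auto
        then show ?thesis by (rule order_trans) simp
      next
        case False
        then have "\<bar>x\<bar> powr q \<le> \<bar>x\<bar> powr real n" using n by (intro powr_mono) auto
        also have "\<dots> = \<bar>x\<bar> ^ n" using False by (subst powr_realpow) auto
        finally show ?thesis by simp
      qed
      then have "std_normal_density x * \<bar>x\<bar> powr q \<le> std_normal_density x * (1 + \<bar>x\<bar> ^ n)"
        by (intro mult_left_mono) auto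
      then show "norm (std_normal_density x * \<bar>x\<bar> powr q)
        \<le> norm (std_normal_density x * \<bar>x\<bar> ^ 0 + std_normal_density x * \<bar>x\<bar> ^ n)"
        by (simp add: abs_mult distrib_left)
    qed
  qed auto
qed

text \<open>Integration by parts: \<open>f\<close> is the derivative of x |x|^q times the density,
  which vanishes at both ends of the line.\<close>

lemma normal_abs_moment_add_2:
  assumes q: "0 < q"
  shows "normal_abs_moment (q + 2) = (q + 1) * normal_abs_moment q"
proof -
  define F where "F = (\<lambda>x::real. x * \<bar>x\<bar> powr q * std_normal_density x)"
  define f where "f = (\<lambda>x::real. (q + 1) * (std_normal_density x * \<bar>x\<bar> powr q) - std_normal_density x * \<bar>x\<bar> powr (q + 2))"
  have int: "integrable lborel f"
    unfolding f_def using q by (intro Bochner_Integration.integrable_diff Bochner_Integration.integrable_mult_right integrable_normal_abs_powr) auto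
  have powr2: "\<bar>x\<bar> powr (q + 2) = x * x * \<bar>x\<bar> powr q" for x :: real
    by (cases "x = 0") (auto simp: powr_add abs_mult_self_eq power2_eq_square)
  have dphi: "(std_normal_density has_real_derivative - x * std_normal_density x) (at x)" for x
  proof -
    define c where "c = 1 / sqrt (2 * pi)"
    have "std_normal_density = (\<lambda>x. c * exp (- x\<^sup>2 / 2))"
      by (simp add: fun_eq_iff std_normal_density_def c_def)
    then show ?thesis by (auto intro!: derivative_eq_intros)
  qed
  have dF: "(F has_real_derivative f x) (at x)" for x
    unfolding F_def f_def powr2
    by (rule derivative_eq_intros has_real_derivative_mult_abs_powr q dphi refl)+ (simp add: algebra_simps)
  have "continuous_on UNIV std_normal_density"
    using DERIV_isCont[OF dphi] by (simp add: continuous_at_imp_continuous_on)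
  then have "continuous_on UNIV f"
    unfolding f_def using q by (intro continuous_intros continuous_on_powr') auto
  then have cont: "isCont f x" for x
    by (simp add: continuous_on_eq_continuous_at)
  have lim_top: "(F \<longlongrightarrow> 0) at_top"
  proof -
    have "((\<lambda>x::real. x * x powr q * (1 / sqrt (2 * pi) * exp (- x\<^sup>2 / 2))) \<longlongrightarrow> 0) at_top"
      by real_asymp
    then show ?thesis
      by (rule Lim_transform_eventually)
        (auto simp: F_def std_normal_density_def intro!: eventually_mono[OF eventually_gt_at_top[of 0]])
  qed
  have "F (- x) = - F x" for x by (simp add: F_def std_normal_density_def)
  then have lim_bot: "(F \<longlongrightarrow> 0) at_bot"
    unfolding filterlim_at_bot_mirror using tendsto_minus[OF lim_top] by simp
  have "(LBINT x=-\<infinity>..\<infinity>. f x) = 0 - 0"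
  proof (rule interval_integral_FTC_integrable)
    show "((F \<circ> real_of_ereal) \<longlongrightarrow> 0) (at_right (-\<infinity>))" "((F \<circ> real_of_ereal) \<longlongrightarrow> 0) (at_left \<infinity>)"
      using lim_bot lim_top by (auto simp: ereal_tendsto_simps)
  qed (use dF cont int in \<open>auto simp: has_real_derivative_iff_has_vector_derivative set_integrable_def\<close>)
  then have "(\<integral>x. f x \<partial>lborel) = 0"
    by (simp add: interval_lebesgue_integral_def set_lebesgue_integral_def)
  then show ?thesis
    using q integrable_normal_abs_powr unfolding f_def normal_abs_moment_def
    by (subst (asm) Bochner_Integration.integral_diff) auto
qed

text \<open>Interpolating between the moments of order \<open>14\<close> and \<open>15\<close> is much less lossy than between \<open>0\<close> and \<open>1\<close>,
  and for small \<open>p\<close> the bound is needed almost sharply.\<close>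

lemma normal_abs_moment_le:
  assumes p: "0 < p" "p < 1"
  defines "l \<equiv> 645120 * sqrt (2 / pi) / 135135"
  shows "normal_abs_moment p * ((p + 1) * (p + 3) * (p + 5) * (p + 7) * (p + 9) * (p + 11) * (p + 13))
    \<le> 135135 * l powr p"
proof -
  \<comment> \<open>135135 = 13!! is the moment of order 14 and 645120 sqrt (2/pi) the absolute
    moment of order 15. Their ratio \<open>l\<close> is the tangent point for |x|^p at which the
    first-order term integrates to zero.\<close>
  have l: "0 < l" by (simp add: l_def)
  have r: "normal_abs_moment (p + real (k + 2)) = (p + real (k + 1)) * normal_abs_moment (p + real k)" for k
    using normal_abs_moment_add_2[of "p + real k"] p by (simp add: add_ac)
  have "normal_abs_moment p * ((p + 1) * (p + 3) * (p + 5) * (p + 7) * (p + 9) * (p + 11) * (p + 13))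
    = normal_abs_moment (p + 14)"
    using r[of 0] r[of 2] r[of 4] r[of 6] r[of 8] r[of 10] r[of 12] by simp
  also have "\<dots> \<le> (\<integral>x. l powr p * (1 - p) * (std_normal_density x * x ^ (2 * 7))
      + l powr p * p / l * (std_normal_density x * \<bar>x\<bar> ^ (2 * 7 + 1)) \<partial>lborel)"
    unfolding normal_abs_moment_def
  proof (rule integral_mono)
    show "integrable lborel (\<lambda>x. std_normal_density x * \<bar>x\<bar> powr (p + 14))"
      using p by (intro integrable_normal_abs_powr) auto
    show "integrable lborel (\<lambda>x. l powr p * (1 - p) * (std_normal_density x * x ^ (2 * 7))
      + l powr p * p / l * (std_normal_density x * \<bar>x\<bar> ^ (2 * 7 + 1)))"
      by (intro Bochner_Integration.integrable_add Bochner_Integration.integrable_mult_right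
          integrable_std_normal_moment integrable_std_normal_moment_abs)
    fix x :: real
    have "\<bar>x\<bar> powr p = l powr p * (\<bar>x\<bar> / l) powr p" using l by (simp add: powr_divide)
    also have "\<dots> \<le> l powr p * (1 + p * (\<bar>x\<bar> / l - 1))"
      using l p by (intro mult_left_mono powr_le_tangent_one) auto
    finally have "std_normal_density x * \<bar>x\<bar> ^ 14 * \<bar>x\<bar> powr p
      \<le> std_normal_density x * \<bar>x\<bar> ^ 14 * (l powr p * (1 + p * (\<bar>x\<bar> / l - 1)))"
      by (intro mult_left_mono) auto
    moreover have "\<bar>x\<bar> powr (p + 14) = \<bar>x\<bar> ^ 14 * \<bar>x\<bar> powr p"
      by (cases "x = 0") (auto simp: powr_add)
    moreover have "\<bar>x\<bar> ^ 14 = x ^ 14" by (simp add: power_even_abs)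
    moreover have "\<bar>x\<bar> ^ 15 = \<bar>x\<bar> ^ 14 * \<bar>x\<bar>" by (simp add: power_Suc2[symmetric] numeral_eq_Suc)
    ultimately show "std_normal_density x * \<bar>x\<bar> powr (p + 14) \<le> l powr p * (1 - p) * (std_normal_density x * x ^ (2 * 7))
      + l powr p * p / l * (std_normal_density x * \<bar>x\<bar> ^ (2 * 7 + 1))"
      by (simp add: algebra_simps)
  qed
  also have "\<dots> = l powr p * (1 - p) * 135135 + l powr p * p / l * (sqrt (2 / pi) * 645120)"
    using integral_std_normal_moment_even[of 7] integral_std_normal_moment_abs_odd[of 7]
    by (subst Bochner_Integration.integral_add)
      (auto simp: fact_numeral simp del: normal_density_def
        intro!: Bochner_Integration.integrable_mult_right integrable_std_normal_moment integrable_std_normal_moment_abs)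
  also have "sqrt (2 / pi) * 645120 = 135135 * l" by (simp add: l_def)
  also have "l powr p * (1 - p) * 135135 + l powr p * p / l * (135135 * l) = 135135 * l powr p"
    using l by (simp add: field_simps)
  finally show ?thesis .
qed

text \<open>The Lagrange remainder of order 5, with exp (53/50) <= 3, so 3 / 5! = 1/40.\<close>

lemma exp_le_quintic:
  fixes x :: real
  assumes x: "0 \<le> x" "x \<le> 53/50"
  shows "exp x \<le> 1 + x + x\<^sup>2 / 2 + x ^ 3 / 6 + x ^ 4 / 24 + x ^ 5 / 40"
proof -
  obtain t where t: "\<bar>t\<bar> \<le> \<bar>x\<bar>" "exp x = (\<Sum>m<5. x ^ m / fact m) + exp t / fact 5 * x ^ 5"
    using Maclaurin_exp_le[of x 5] by auto
  have "(1 + (- 53/100) + (- 53/100)\<^sup>2 / 2 + (- 53/100) ^ 3 / 6)\<^sup>2 \<le> exp (- 53/100 :: real) ^ 2"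
    by (intro power_mono exp_ge_cubic) (simp add: power_divide)
  also have "\<dots> = exp (- (53/50))" by (simp flip: exp_of_nat_mult)
  finally have "1 / 3 \<le> exp (- (53/50 :: real))" by (simp add: power_divide)
  then have e3: "exp (53/50 :: real) \<le> 3" by (simp add: exp_minus field_simps)
  have "exp t \<le> exp (53/50)" using t(1) x by simp
  from this e3 have "exp t \<le> 3" by (rule order_trans)
  then have "exp t / fact 5 \<le> 1 / 40" by (simp add: fact_numeral)
  then have "exp t / fact 5 * x ^ 5 \<le> 1 / 40 * x ^ 5" using x by (intro mult_right_mono) auto
  then show ?thesis unfolding t(2) by (simp add: numeral_eq_Suc)
qed

text \<open>\<open>1392/12500\<close> is the value of \<open>(s - 1) / 6 - (s - 1)\<^sup>2 / 60\<close> at \<open>s = 43/25\<close>.\<close>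

lemma odd_product_ge:
  fixes p :: real
  assumes p: "0 \<le> p" "p \<le> 1"
  shows "135135 * exp (53/50 * p)
    \<le> (p + 3) * (p + 5) * (p + 7) * (p + 9) * (p + 11) * (p + 13) * (1 + p * (1 + p) * (1392/12500))"
proof -
  have pk: "0 \<le> p ^ k" for k using p by simp
  have dec: "p\<^sup>2 \<le> p" "p ^ 3 \<le> p\<^sup>2" "p ^ 4 \<le> p ^ 3" "p ^ 5 \<le> p ^ 4"
    using p by (auto intro: power_decreasing power_decreasing[of 1 2 p, simplified])
  have A: "(p + 3) * (p + 5) * (p + 7) * (p + 9) * (p + 11) * (p + 13)
    = p ^ 6 + 48 * p ^ 5 + 925 * p ^ 4 + 9120 * p ^ 3 + 48259 * p\<^sup>2 + 129072 * p + 135135"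
    by (simp add: numeral_eq_Suc algebra_simps)
  have "exp (53/50 * p) \<le> 1 + 53/50 * p + (53/50 * p)\<^sup>2 / 2 + (53/50 * p) ^ 3 / 6 + (53/50 * p) ^ 4 / 24 + (53/50 * p) ^ 5 / 40"
    using p by (intro exp_le_quintic) auto
  also have "\<dots> = 1 + 53/50 * p + (53/50)\<^sup>2 / 2 * p\<^sup>2 + (53/50) ^ 3 / 6 * p ^ 3 + (53/50) ^ 4 / 24 * p ^ 4 + (53/50) ^ 5 / 40 * p ^ 5"
    by (simp add: power_mult_distrib power_divide)
  finally have E: "exp (53/50 * p) \<le> 1 + 53/50 * p + 2809/5000 * p\<^sup>2 + 148877/750000 * p ^ 3 + 7890481/150000000 * p ^ 4 + 418195493/12500000000 * p ^ 5"
    by (simp add: power_divide)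
  have R: "(p ^ 6 + 48 * p ^ 5 + 925 * p ^ 4 + 9120 * p ^ 3 + 48259 * p\<^sup>2 + 129072 * p + 135135) * (1 + p * (1 + p) * g)
    = 135135 + (129072 + 135135 * g) * p + (48259 + (129072 + 135135) * g) * p\<^sup>2 + (9120 + (48259 + 129072) * g) * p ^ 3
      + (925 + (9120 + 48259) * g) * p ^ 4 + (48 + (925 + 9120) * g) * p ^ 5 + (1 + (48 + 925) * g) * p ^ 6
      + (1 + 48) * g * p ^ 7 + g * p ^ 8" for g
    by (simp add: numeral_eq_Suc algebra_simps)
  \<comment> \<open>Coefficientwise the right side wins for p to p^4 and loses at p^5; as the powers
    of \<open>p\<close> decrease, the lower surpluses cover that deficit.\<close>
  show ?thesis
    unfolding A R using E dec p(1) pk[of 5] pk[of 6] pk[of 7] pk[of 8] by argo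
qed

text \<open>This is what the conditioning argument needs once the moments of Y are inserted, with s
  = 1 / a_i^2. It is proved numerically at \<open>s = 43/25\<close>; moving \<open>s\<close> down by
  \<open>e\<close>, the bound for \<open>s powr (p / 2)\<close> shrinks at least as fast as the
  right side.\<close>

lemma gauss_moment_le:
  fixes p s :: real
  assumes p: "0 < p" "p < 1" and s: "1 \<le> s" "s \<le> 43/25"
  shows "(1 + p) * (3 powr (- p / 2) * normal_abs_moment p)
    \<le> s powr (- p / 2) * (1 + p * (1 + p) * ((s - 1) / 6 - (s - 1)\<^sup>2 / 60))"
proof -
  define l where "l = 645120 * sqrt (2 / pi) / 135135"
  have l0: "0 < l" by (simp add: l_def)
  \<comment> \<open>53/25 is just above the logarithm of 8.3184; its half is the rate 53/50 in the
    polynomial comparison.\<close>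
  have l2: "l\<^sup>2 * (43/75) \<le> exp (53/25)"
  proof -
    have "l\<^sup>2 = (645120 / 135135)\<^sup>2 * (2 / pi)"
      unfolding l_def by (simp add: power_divide power_mult_distrib)
    also have "\<dots> \<le> (645120 / 135135)\<^sup>2 * (2 / 3.141592653588)"
      using pi_approx by (intro mult_left_mono divide_left_mono) auto
    finally have "l\<^sup>2 * (43/75) \<le> 8.3184" by (simp add: power_divide)
    also have "\<dots> \<le> (1 + 53/200 + (53/200)\<^sup>2 / 2 + (53/200) ^ 3 / 6) ^ 8"
      by (simp add: power_divide)
    also have "\<dots> \<le> exp (53/200) ^ 8" by (intro power_mono exp_ge_cubic) (simp add: power_divide)
    also have "\<dots> = exp (53/25)" by (simp flip: exp_of_nat_mult)
    finally show ?thesis .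
  qed
  define P where "P = (p + 3) * (p + 5) * (p + 7) * (p + 9) * (p + 11) * (p + 13)"
  have P0: "0 < P" unfolding P_def using p by (intro mult_pos_pos) auto
  define m where "m = (1 + p) * (3 powr (- p / 2) * normal_abs_moment p)"
  have m0: "0 \<le> m" unfolding m_def normal_abs_moment_def using p
    by (intro mult_nonneg_nonneg Bochner_Integration.integral_nonneg) auto
  have "(43/25) powr (p / 2) * m * P = (43/75) powr (p / 2) * (normal_abs_moment p * ((p + 1) * P))"
  proof -
    have "(43/25 :: real) powr (p / 2) = (43/75) powr (p / 2) * 3 powr (p / 2)"
      by (simp flip: powr_mult)
    have "3 powr (p / 2) * 3 powr (- p / 2) = (1::real)" by (simp flip: powr_add)
    moreover have "(43/25) powr (p / 2) * m * P
      = (43/75) powr (p / 2) * (normal_abs_moment p * ((p + 1) * P)) * (3 powr (p / 2) * 3 powr (- p / 2))"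
      unfolding m_def \<open>(43/25) powr (p / 2) = _\<close> by (simp only: mult_ac add.commute)
    ultimately show ?thesis by simp
  qed
  also have "\<dots> \<le> (43/75) powr (p / 2) * (135135 * l powr p)"
    using normal_abs_moment_le[OF p] unfolding l_def[symmetric] P_def
    by (intro mult_left_mono) (auto simp: mult_ac)
  also have "\<dots> = 135135 * (l\<^sup>2 * (43/75)) powr (p / 2)"
  proof -
    have "(l\<^sup>2) powr (p / 2) = l powr p" using l0 by (simp add: powr_powr flip: powr_numeral)
    moreover have "(l\<^sup>2 * (43/75)) powr (p / 2) = (l\<^sup>2) powr (p / 2) * (43/75) powr (p / 2)"
      by (rule powr_mult)
    ultimately show ?thesis by simp
  qed
  also have "\<dots> \<le> 135135 * exp (53/25) powr (p / 2)"
    using l2 p by (intro mult_left_mono powr_mono2) auto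
  also have "\<dots> = 135135 * exp (53/50 * p)" by (simp add: powr_def)
  also have "\<dots> \<le> P * (1 + p * (1 + p) * (1392/12500))"
    unfolding P_def using p by (intro odd_product_ge) auto
  finally have main: "(43/25) powr (p / 2) * m \<le> 1 + p * (1 + p) * (1392/12500)"
    using P0 by (simp add: mult.commute[of _ P] mult.left_commute[of _ P])
  define B where "B = 1 + p * (1 + p) * (1392/12500)"
  define e where "e = 43/25 - s"
  have e0: "0 \<le> e" using s by (simp add: e_def)
  have "s powr (p / 2) = (43/25) powr (p / 2) * (s * (25/43)) powr (p / 2)"
    using s by (simp flip: powr_mult)
  also have "\<dots> \<le> (43/25) powr (p / 2) * (1 + p / 2 * (s * (25/43) - 1))"
    using s p by (intro mult_left_mono powr_le_tangent_one) auto
  finally have "s powr (p / 2) * m \<le> (43/25) powr (p / 2) * (1 + p / 2 * (s * (25/43) - 1)) * m"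
    using m0 by (intro mult_right_mono) auto
  also have "\<dots> = (1 - p * e * (25/86)) * ((43/25) powr (p / 2) * m)"
    by (simp add: e_def field_simps)
  also have "\<dots> \<le> (1 - p * e * (25/86)) * B"
  proof (intro mult_left_mono)
    have "p * e \<le> 1 * 1" using p s e0 by (intro mult_mono) (auto simp: e_def)
    then show "0 \<le> 1 - p * e * (25/86)" by simp
  qed (use main in \<open>simp add: B_def\<close>)
  also have "\<dots> \<le> 1 + p * (1 + p) * ((s - 1) / 6 - (s - 1)\<^sup>2 / 60)"
  proof -
    \<comment> \<open>The left side, times p e, bounds what the right side of the claim loses; the
      right side, times p e, is what the tangent of \<open>s powr (p / 2)\<close> at 43/25
      saves.\<close>
    have key: "(1 + p) / 6 \<le> 25/86 * B"
    proof -
      have "0 \<le> (p - 1)\<^sup>2" by simp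
      then have "2 * p - 1 \<le> p\<^sup>2" by (simp add: power2_eq_square algebra_simps)
      moreover have "B = 1 + 1392/12500 * p + 1392/12500 * p\<^sup>2"
        by (simp add: B_def power2_eq_square algebra_simps)
      ultimately show ?thesis using p by argo
    qed
    have g: "(s - 1) / 6 - (s - 1)\<^sup>2 / 60 = 1392/12500 - e / 6 + e * (36/25 - e) / 60"
      unfolding e_def by (simp add: field_simps power2_eq_square)
    have "p * e * ((1 + p) / 6) \<le> p * e * (25/86 * B)"
      using key p e0 by (intro mult_left_mono) auto
    moreover have "0 \<le> p * (1 + p) * (e * (36/25 - e) / 60)"
      using p e0 s by (intro mult_nonneg_nonneg divide_nonneg_nonneg) (auto simp: e_def)
    ultimately show ?thesis unfolding g B_def by (simp add: field_simps)
  qed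
  finally have "s powr (- p / 2) * (s powr (p / 2) * m) \<le> s powr (- p / 2) * (1 + p * (1 + p) * ((s - 1) / 6 - (s - 1)\<^sup>2 / 60))"
    by (intro mult_left_mono) auto
  moreover have eq: "s powr (- p / 2) * (s powr (p / 2) * m) = m"
    using s by (simp flip: powr_add mult.assoc)
  ultimately show ?thesis unfolding eq unfolding m_def by blast
qed

subsection \<open>A large coefficient\<close>

lemma (in prob_space) uniform_expectation:
  fixes U :: "'a \<Rightarrow> real" and f :: "real \<Rightarrow> real"
  assumes U: "distributed M lborel U (\<lambda>x. indicator {-1..1} x / measure lborel {-1..1::real})"
    and [measurable]: "f \<in> borel_measurable borel"
  shows "(\<integral>\<omega>. f (U \<omega>) \<partial>M) = (\<integral>x. f x * indicator {-1..1} x \<partial>lborel) / 2"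
proof -
  have "(\<integral>\<omega>. f (U \<omega>) \<partial>M) = (\<integral>x. indicator {-1..1} x / 2 * f x \<partial>lborel)"
    using distributed_integral[OF U, of f] by simp
  also have "\<dots> = (\<integral>x. f x * indicator {-1..1} x / 2 \<partial>lborel)"
    by (intro Bochner_Integration.integral_cong) auto
  finally show ?thesis by simp
qed

lemma (in prob_space) uniform_abs_le_one:
  fixes U :: "'a \<Rightarrow> real"
  assumes U: "distributed M lborel U (\<lambda>x. indicator {-1..1} x / measure lborel {-1..1::real})"
  shows "AE \<omega> in M. \<bar>U \<omega>\<bar> \<le> 1"
proof -
  have [measurable]: "U \<in> borel_measurable M" using distributed_measurable[OF U] by simp
  have "AE x in distr M lborel U. \<bar>x\<bar> \<le> 1"
    unfolding distributed_distr_eq_density[OF U]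
    unfolding AE_density[OF distributed_borel_measurable[OF U]]
  proof (intro AE_I2 impI)
    fix x :: real
    assume "0 < ennreal (indicator {-1..1} x / measure lborel {-1..1::real})"
    then have "x \<in> {-1..1}" by (auto simp: indicator_def split: if_splits)
    then show "\<bar>x\<bar> \<le> 1" by auto
  qed
  then show ?thesis by (subst (asm) AE_distr_iff) auto
qed

lemma (in prob_space) uniform_power_moment:
  fixes U :: "'a \<Rightarrow> real"
  assumes U: "distributed M lborel U (\<lambda>x. indicator {-1..1} x / measure lborel {-1..1::real})"
  shows "(\<integral>\<omega>. U \<omega> ^ k \<partial>M) = (1 - (- 1) ^ Suc k) / (2 * (real k + 1))"
  using uniform_expectation[OF U, of "\<lambda>x. x ^ k"] integral_power[of "-1" 1 k] by (simp add: add.commute)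

lemma (in prob_space) integrable_power_bounded:
  fixes X :: "'a \<Rightarrow> real"
  assumes [measurable]: "X \<in> borel_measurable M" and "AE \<omega> in M. \<bar>X \<omega>\<bar> \<le> B"
  shows "integrable M (\<lambda>\<omega>. X \<omega> ^ k)"
proof (rule integrable_const_bound)
  show "AE \<omega> in M. norm (X \<omega> ^ k) \<le> B ^ k"
    using assms(2) by eventually_elim (auto simp: power_abs intro: power_mono)
qed measurable

section \<open>Moments of weighted sums of independent uniform variables\<close>

context prob_space
begin

context
  fixes U :: "nat \<Rightarrow> 'a \<Rightarrow> real" and J :: "nat set" and a :: "nat \<Rightarrow> real"
  assumes indep: "indep_vars (\<lambda>_. borel) U J"
    and unif: "\<And>j. j \<in> J \<Longrightarrow> distributed M lborel (U j) (\<lambda>x. indicator {-1..1} x / measure lborel {-1..1::real})"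
begin

lemma uniform_measurable: "j \<in> J \<Longrightarrow> U j \<in> borel_measurable M"
  using distributed_measurable[OF unif] by simp

lemma uniform_sum_measurable: "S \<subseteq> J \<Longrightarrow> (\<lambda>\<omega>. \<Sum>j\<in>S. a j * U j \<omega>) \<in> borel_measurable M"
  using uniform_measurable by (intro borel_measurable_sum borel_measurable_times) auto

lemma uniform_sum_bounded:
  assumes "finite S" "S \<subseteq> J"
  shows "AE \<omega> in M. \<bar>\<Sum>j\<in>S. a j * U j \<omega>\<bar> \<le> (\<Sum>j\<in>S. \<bar>a j\<bar>)"
proof -
  have "AE \<omega> in M. \<forall>j\<in>S. \<bar>U j \<omega>\<bar> \<le> 1"
    using assms by (intro AE_finite_allI uniform_abs_le_one unif) auto
  then show ?thesis
  proof eventually_elim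
    case (elim \<omega>)
    have "\<bar>\<Sum>j\<in>S. a j * U j \<omega>\<bar> \<le> (\<Sum>j\<in>S. \<bar>a j * U j \<omega>\<bar>)" by (rule sum_abs)
    also have "\<dots> \<le> (\<Sum>j\<in>S. \<bar>a j\<bar> * 1)"
      using elim unfolding abs_mult by (intro sum_mono mult_left_mono) auto
    finally show ?case by simp
  qed
qed

lemma uniform_sum_power_integrable:
  assumes "finite S" "S \<subseteq> J"
  shows "integrable M (\<lambda>\<omega>. (\<Sum>j\<in>S. a j * U j \<omega>) ^ k)"
  using uniform_sum_measurable uniform_sum_bounded assms by (intro integrable_power_bounded) auto

lemma uniform_sum_indep:
  assumes "finite S" "insert i S \<subseteq> J" "i \<notin> S"
  shows "indep_var borel (\<lambda>\<omega>. a i * U i \<omega>) borel (\<lambda>\<omega>. \<Sum>j\<in>S. a j * U j \<omega>)"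
proof -
  have "indep_vars (\<lambda>_. borel) (\<lambda>j \<omega>. a j * U j \<omega>) (insert i S)"
    using indep_vars_subset[OF indep assms(2)] by (rule indep_vars_compose2) auto
  then show ?thesis using assms by (intro indep_vars_sum) auto
qed

text \<open>The fourth moment is bounded by that of a Gaussian with the same variance. In the
  induction the mixed terms agree exactly with those of (a_i^2 + v)^2 / 3, and a_i^4 / 5 is below
  a_i^4 / 3. The vanishing odd moments are carried along for the binomial expansion.\<close>

lemma uniform_sum_moments:
  assumes "finite S" "S \<subseteq> J"
  defines "Y \<equiv> \<lambda>\<omega>. \<Sum>j\<in>S. a j * U j \<omega>" and "v \<equiv> \<Sum>j\<in>S. (a j)\<^sup>2"
  shows "(\<integral>\<omega>. Y \<omega> \<partial>M) = 0 \<and> (\<integral>\<omega>. Y \<omega> ^ 3 \<partial>M) = 0 \<and> (\<integral>\<omega>. (Y \<omega>)\<^sup>2 \<partial>M) = v / 3 \<and>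
    (\<integral>\<omega>. Y \<omega> ^ 4 \<partial>M) \<le> v\<^sup>2 / 3"
  using assms(1,2) unfolding Y_def v_def
proof (induction S rule: finite_induct)
  case (insert i S)
  define A where "A = (\<lambda>\<omega>. a i * U i \<omega>)"
  define Y where "Y = (\<lambda>\<omega>. \<Sum>j\<in>S. a j * U j \<omega>)"
  define v where "v = (\<Sum>j\<in>S. (a j)\<^sup>2)"
  have IH: "(\<integral>\<omega>. Y \<omega> \<partial>M) = 0" "(\<integral>\<omega>. Y \<omega> ^ 3 \<partial>M) = 0" "(\<integral>\<omega>. (Y \<omega>)\<^sup>2 \<partial>M) = v / 3"
    "(\<integral>\<omega>. Y \<omega> ^ 4 \<partial>M) \<le> v\<^sup>2 / 3"
    using insert by (auto simp: Y_def v_def)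
  have iv: "indep_var borel A borel Y"
    unfolding A_def Y_def using insert by (intro uniform_sum_indep) auto
  have intY: "integrable M (\<lambda>\<omega>. Y \<omega> ^ k)" for k
    unfolding Y_def using insert by (intro uniform_sum_power_integrable) auto
  have intA: "integrable M (\<lambda>\<omega>. A \<omega> ^ k)" for k
    unfolding A_def using uniform_sum_power_integrable[of "{i}" k] insert by simp
  have A: "(\<integral>\<omega>. A \<omega> ^ k \<partial>M) = a i ^ k * ((1 - (- 1) ^ Suc k) / (2 * (real k + 1)))" for k
    using uniform_power_moment[OF unif, of i k] insert by (simp add: A_def power_mult_distrib)
  have ivk: "indep_var borel (\<lambda>\<omega>. A \<omega> ^ k) borel (\<lambda>\<omega>. Y \<omega> ^ l)" for k l
    using indep_var_compose[OF iv, of "\<lambda>x. x ^ k" borel "\<lambda>x. x ^ l" borel] by (simp add: comp_def)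
  have prod: "(\<integral>\<omega>. A \<omega> ^ k * Y \<omega> ^ l \<partial>M) = (\<integral>\<omega>. A \<omega> ^ k \<partial>M) * (\<integral>\<omega>. Y \<omega> ^ l \<partial>M)"
    and int: "integrable M (\<lambda>\<omega>. A \<omega> ^ k * Y \<omega> ^ l)" for k l
    using indep_var_lebesgue_integral[OF ivk intA intY] indep_var_integrable[OF ivk intA intY] by auto
  have binom: "(\<integral>\<omega>. (A \<omega> + Y \<omega>) ^ n \<partial>M) = (\<Sum>k\<le>n. real (n choose k) * ((\<integral>\<omega>. A \<omega> ^ k \<partial>M) * (\<integral>\<omega>. Y \<omega> ^ (n - k) \<partial>M)))" for n
  proof -
    have "(\<integral>\<omega>. (A \<omega> + Y \<omega>) ^ n \<partial>M) = (\<integral>\<omega>. (\<Sum>k\<le>n. real (n choose k) * (A \<omega> ^ k * Y \<omega> ^ (n - k))) \<partial>M)"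
      by (simp add: binomial_ring mult.assoc)
    also have "\<dots> = (\<Sum>k\<le>n. (\<integral>\<omega>. real (n choose k) * (A \<omega> ^ k * Y \<omega> ^ (n - k)) \<partial>M))"
      using int by (intro Bochner_Integration.integral_sum) auto
    finally show ?thesis by (simp add: prod)
  qed
  have Y0: "(\<integral>\<omega>. Y \<omega> ^ 0 \<partial>M) = 1" "(\<integral>\<omega>. Y \<omega> ^ Suc 0 \<partial>M) = 0" using IH by (simp_all add: prob_space)
  have sums: "(\<Sum>j\<in>insert i S. a j * U j \<omega>) = A \<omega> + Y \<omega>" "(\<Sum>j\<in>insert i S. (a j)\<^sup>2) = (a i)\<^sup>2 + v" for \<omega>
    using insert by (simp_all add: A_def Y_def v_def)
  have 1: "(\<integral>\<omega>. A \<omega> + Y \<omega> \<partial>M) = 0"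
    using binom[of 1] Y0 IH by (simp add: A)
  have 2: "(\<integral>\<omega>. (A \<omega> + Y \<omega>) ^ 2 \<partial>M) = ((a i)\<^sup>2 + v) / 3"
    using binom[of 2] Y0 IH by (simp add: A numeral_2_eq_2 power2_eq_square)
  have 3: "(\<integral>\<omega>. (A \<omega> + Y \<omega>) ^ 3 \<partial>M) = 0"
    using binom[of 3] Y0 IH by (simp add: A eval_nat_numeral)
  have "(\<integral>\<omega>. (A \<omega> + Y \<omega>) ^ 4 \<partial>M) = a i ^ 4 / 5 + 6 * ((a i)\<^sup>2 / 3 * (v / 3)) + (\<integral>\<omega>. Y \<omega> ^ 4 \<partial>M)"
    using binom[of 4] Y0 IH by (simp add: A eval_nat_numeral)
  also have "\<dots> \<le> ((a i)\<^sup>2 + v)\<^sup>2 / 3"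
  proof -
    have "((a i)\<^sup>2 + v)\<^sup>2 = a i ^ 4 + 2 * ((a i)\<^sup>2 * v) + v\<^sup>2"
      by (simp add: power2_eq_square power4_eq_xxxx algebra_simps)
    moreover have nn: "0 \<le> a i ^ 4" by simp
    ultimately show ?thesis using IH(4) by simp (use nn in linarith)
  qed
  finally show ?case unfolding sums using 1 2 3 by simp
qed (simp_all add: prob_space)

lemma nn_integral_uniform_shift:
  assumes j: "j \<in> J" and b: "b \<noteq> 0" and p: "0 < p"
  shows "(\<integral>\<^sup>+\<omega>. ennreal (\<bar>b * U j \<omega> + y\<bar> powr p) \<partial>M) = ennreal (\<bar>b\<bar> powr p / (1 + p) * uniform_moment p (y / \<bar>b\<bar>))"
proof -
  define H where "H = (\<lambda>u. (b * u + y) * \<bar>b * u + y\<bar> powr p / ((p + 1) * b))"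
  have "(\<integral>\<^sup>+\<omega>. ennreal (\<bar>b * U j \<omega> + y\<bar> powr p) \<partial>M)
    = (\<integral>\<^sup>+u. ennreal (indicator {-1..1} u / measure lborel {-1..1::real}) * ennreal (\<bar>b * u + y\<bar> powr p) \<partial>lborel)"
    by (rule distributed_nn_integral[OF unif[OF j], symmetric]) measurable
  also have "\<dots> = (\<integral>\<^sup>+u. ennreal (\<bar>b * u + y\<bar> powr p / 2) * indicator {-1..1} u \<partial>lborel)"
    by (intro nn_integral_cong) (auto simp: indicator_def simp flip: ennreal_mult)
  also have "\<dots> = ennreal (H 1 / 2 - H (-1) / 2)"
  proof (intro nn_integral_FTC_Icc)
    fix u :: real
    have "((\<lambda>u. (b * u + y) * \<bar>b * u + y\<bar> powr p) has_real_derivative (p + 1) * \<bar>b * u + y\<bar> powr p * b) (at u)"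
      by (rule DERIV_chain2[OF has_real_derivative_mult_abs_powr[OF p]]) (auto intro!: derivative_eq_intros)
    from DERIV_cdivide[OF this, of "(p + 1) * b * 2"]
    have "((\<lambda>u. H u / 2) has_real_derivative (p + 1) * \<bar>b * u + y\<bar> powr p * b / ((p + 1) * b * 2)) (at u)"
      by (simp only: H_def divide_divide_eq_left)
    moreover have "(p + 1) * \<bar>b * u + y\<bar> powr p * b / ((p + 1) * b * 2) = \<bar>b * u + y\<bar> powr p / 2"
      using b p by (simp add: divide_simps)
    ultimately show "((\<lambda>u. H u / 2) has_real_derivative \<bar>b * u + y\<bar> powr p / 2) (at u)"
      by simp
  qed auto
  also have "H 1 / 2 - H (-1) / 2 = \<bar>b\<bar> powr p / (1 + p) * uniform_moment p (y / \<bar>b\<bar>)"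
  proof -
    have scale: "\<bar>b\<bar> powr p * (\<bar>b\<bar> * ((y / \<bar>b\<bar> + c) * \<bar>y / \<bar>b\<bar> + c\<bar> powr p)) = (y + c * \<bar>b\<bar>) * \<bar>y + c * \<bar>b\<bar>\<bar> powr p" for c
    proof -
      have "y + c * \<bar>b\<bar> = \<bar>b\<bar> * (y / \<bar>b\<bar> + c)" using b by (simp add: field_simps)
      then show ?thesis by (simp only: abs_mult powr_mult abs_abs mult_ac)
    qed
    define Q where "Q = \<bar>b\<bar> powr p * uniform_moment p (y / \<bar>b\<bar>)"
    \<comment> \<open>Written with \<open>T\<close>, a change of sign of \<open>b\<close> merely
      swaps the two end values, which leads to the same formula in |b|.\<close>
    define T where "T = (\<lambda>c. (y + c) * \<bar>y + c\<bar> powr p)"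
    have 1: "\<bar>b\<bar> * Q = (T \<bar>b\<bar> - T (- \<bar>b\<bar>)) / 2"
    proof -
      have "c * (d * ((X1 - X2) / 2)) = (d * (c * X1) - d * (c * X2)) / 2" for c d X1 X2 :: real
        by (simp add: field_simps)
      moreover have "uniform_moment p (y / \<bar>b\<bar>) = ((y / \<bar>b\<bar> + 1) * \<bar>y / \<bar>b\<bar> + 1\<bar> powr p - (y / \<bar>b\<bar> + - 1) * \<bar>y / \<bar>b\<bar> + - 1\<bar> powr p) / 2"
        by (simp only: uniform_moment_def diff_conv_add_uminus)
      ultimately show ?thesis by (simp only: Q_def scale) (simp add: T_def)
    qed
    have 2: "b * ((p + 1) * (H 1 - H (-1))) = T b - T (- b)"
      using b p by (simp add: H_def T_def diff_divide_distrib[symmetric] add.commute)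
    have "b * ((p + 1) * (H 1 - H (-1))) = b * (2 * Q)"
    proof (cases "0 \<le> b")
      case True
      with 1 have "b * Q = (T b - T (- b)) / 2" by simp
      with 2 show ?thesis by simp
    next
      case False
      with 1 have "- (b * Q) = (T (- b) - T b) / 2" by simp
      with 2 show ?thesis by simp
    qed
    then have "(p + 1) * (H 1 - H (-1)) = 2 * Q" using b by simp
    then have "H 1 / 2 - H (-1) / 2 = Q / (1 + p)" using p by (simp add: field_simps)
    then show ?thesis by (simp add: Q_def)
  qed
  finally show ?thesis .
qed

lemma uniform_sum_large_coefficient:
  assumes S: "finite S" "insert i S \<subseteq> J" "i \<notin> S" and sum1: "(\<Sum>j\<in>insert i S. (a j)\<^sup>2) = 1"
    and i: "25/43 \<le> (a i)\<^sup>2" and p: "0 < p" "p < 1"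
  shows "ennreal (3 powr (- p / 2) * normal_abs_moment p) \<le> (\<integral>\<^sup>+\<omega>. ennreal (\<bar>\<Sum>j\<in>insert i S. a j * U j \<omega>\<bar> powr p) \<partial>M)"
proof -
  define A where "A = (\<lambda>\<omega>. a i * U i \<omega>)"
  define Y where "Y = (\<lambda>\<omega>. \<Sum>j\<in>S. a j * U j \<omega>)"
  define v where "v = (\<Sum>j\<in>S. (a j)\<^sup>2)"
  define b where "b = \<bar>a i\<bar>"
  have b: "0 < b" "a i \<noteq> 0" using i by (auto simp: b_def)
  define s where "s = 1 / b\<^sup>2"
  have v: "b\<^sup>2 + v = 1" "0 \<le> v" using sum1 S by (auto simp: b_def v_def sum_nonneg)
  have s: "1 \<le> s" "s \<le> 43/25" using v b i by (auto simp: s_def b_def field_simps)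
  have vs: "v / b\<^sup>2 = s - 1" using v(1) b by (simp add: s_def field_simps)
  have iS: "i \<in> J" using S by auto
  have [measurable]: "U i \<in> borel_measurable M" by (rule uniform_measurable[OF iS])
  have [measurable]: "A \<in> borel_measurable M" unfolding A_def by measurable
  have [measurable]: "Y \<in> borel_measurable M"
    unfolding Y_def using S by (intro uniform_sum_measurable) auto
  have iv: "indep_var borel A borel Y"
    unfolding A_def Y_def using S by (intro uniform_sum_indep) auto
  have intY: "integrable M (\<lambda>\<omega>. Y \<omega> ^ k)" for k
    unfolding Y_def using S by (intro uniform_sum_power_integrable) auto
  have momY: "(\<integral>\<omega>. (Y \<omega>)\<^sup>2 \<partial>M) = v / 3" "(\<integral>\<omega>. Y \<omega> ^ 4 \<partial>M) \<le> v\<^sup>2 / 3"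
    using uniform_sum_moments[of S] S unfolding Y_def v_def by auto
  \<comment> \<open>The conditional lower bound given Y = y. It is negative for large |y|, so
    passing to \<open>ennreal\<close> truncates it.\<close>
  define h where "h = (\<lambda>y. b powr p / (1 + p) * (1 + p * (1 + p) * ((y / b)\<^sup>2 / 2 - (y / b) ^ 4 / 20)))"
  have [measurable]: "h \<in> borel_measurable borel" unfolding h_def by measurable
  have h_le: "ennreal (h y) \<le> (\<integral>\<^sup>+x. ennreal (\<bar>x + y\<bar> powr p) \<partial>distr M borel A)" for y
  proof -
    have "h y \<le> b powr p / (1 + p) * uniform_moment p (y / b)"
      unfolding h_def using p b by (intro mult_left_mono uniform_moment_ge) auto
    then have "ennreal (h y) \<le> (\<integral>\<^sup>+\<omega>. ennreal (\<bar>a i * U i \<omega> + y\<bar> powr p) \<partial>M)"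
      unfolding nn_integral_uniform_shift[OF iS b(2) p(1)] b_def by (rule ennreal_leI)
    also have "\<dots> = (\<integral>\<^sup>+x. ennreal (\<bar>x + y\<bar> powr p) \<partial>distr M borel A)"
      by (subst nn_integral_distr) (auto simp: A_def)
    finally show ?thesis .
  qed
  have int_h: "integrable M (\<lambda>\<omega>. h (Y \<omega>))"
    unfolding h_def power_divide using intY[of 2] intY[of 4] by simp
  have "(1 + p) * (3 powr (- p / 2) * normal_abs_moment p) \<le> b powr p * (1 + p * (1 + p) * ((s - 1) / 6 - (s - 1)\<^sup>2 / 60))"
  proof -
    have "s powr (- p / 2) = b powr p"
    proof -
      have "s = b powr (- 2)" using b by (simp add: s_def powr_minus_divide)
      then show ?thesis by (simp only: powr_powr) simp
    qed
    then show ?thesis using gauss_moment_le[OF p s] by simp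
  qed
  then have "3 powr (- p / 2) * normal_abs_moment p
    \<le> b powr p / (1 + p) * (1 + p * (1 + p) * ((s - 1) / 6 - (s - 1)\<^sup>2 / 60))"
    using p by (simp add: field_simps)
  also have "\<dots> \<le> (\<integral>\<omega>. h (Y \<omega>) \<partial>M)"
  proof -
    have "(\<integral>\<omega>. h (Y \<omega>) \<partial>M) = b powr p / (1 + p) * (1 + p * (1 + p) *
        ((\<integral>\<omega>. (Y \<omega>)\<^sup>2 \<partial>M) / b\<^sup>2 / 2 - (\<integral>\<omega>. Y \<omega> ^ 4 \<partial>M) / b ^ 4 / 20))"
      unfolding h_def power_divide using intY[of 2] intY[of 4] by (simp add: prob_space)
    moreover have "(\<integral>\<omega>. (Y \<omega>)\<^sup>2 \<partial>M) / b\<^sup>2 / 2 = (s - 1) / 6" unfolding momY vs[symmetric] by simp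
    moreover have "(\<integral>\<omega>. Y \<omega> ^ 4 \<partial>M) / b ^ 4 / 20 \<le> (s - 1)\<^sup>2 / 60"
    proof -
      have "(\<integral>\<omega>. Y \<omega> ^ 4 \<partial>M) / b ^ 4 / 20 \<le> v\<^sup>2 / 3 / b ^ 4 / 20"
        using momY(2) b by (intro divide_right_mono) auto
      also have "\<dots> = (v / b\<^sup>2)\<^sup>2 / 60" by (simp add: power_divide flip: power_mult)
      finally show ?thesis by (simp add: vs)
    qed
    ultimately show ?thesis using p b
      by (simp only:) (intro mult_left_mono add_left_mono diff_mono; simp)
  qed
  also have "ennreal (\<integral>\<omega>. h (Y \<omega>) \<partial>M) \<le> (\<integral>\<^sup>+\<omega>. ennreal (h (Y \<omega>)) \<partial>M)"
  proof -
    \<comment> \<open>Truncation at 0 can only increase the integral, so the real expectation of the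
      minorant remains a lower bound.\<close>
    have "(\<integral>\<omega>. h (Y \<omega>) \<partial>M) \<le> (\<integral>\<omega>. max 0 (h (Y \<omega>)) \<partial>M)"
      using int_h by (intro integral_mono) auto
    then have "ennreal (\<integral>\<omega>. h (Y \<omega>) \<partial>M) \<le> ennreal (\<integral>\<omega>. max 0 (h (Y \<omega>)) \<partial>M)" by (rule ennreal_leI)
    also have "\<dots> = (\<integral>\<^sup>+\<omega>. ennreal (max 0 (h (Y \<omega>))) \<partial>M)"
      using int_h by (intro nn_integral_eq_integral[symmetric]) auto
    finally show ?thesis by simp
  qed
  also have "\<dots> = (\<integral>\<^sup>+y. ennreal (h y) \<partial>distr M borel Y)" by (simp add: nn_integral_distr)
  also have "\<dots> \<le> (\<integral>\<^sup>+y. (\<integral>\<^sup>+x. ennreal (\<bar>x + y\<bar> powr p) \<partial>distr M borel A) \<partial>distr M borel Y)"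
    by (intro nn_integral_mono h_le)
  also have "\<dots> = (\<integral>\<^sup>+z. ennreal (\<bar>fst z + snd z\<bar> powr p) \<partial>(distr M borel A \<Otimes>\<^sub>M distr M borel Y))"
  proof -
    interpret DA: prob_space "distr M borel A" by (rule prob_space_distr) simp
    interpret DY: prob_space "distr M borel Y" by (rule prob_space_distr) simp
    interpret pair_sigma_finite "distr M borel A" "distr M borel Y" ..
    have "(\<integral>\<^sup>+y. (\<integral>\<^sup>+x. ennreal (\<bar>x + y\<bar> powr p) \<partial>distr M borel A) \<partial>distr M borel Y)
      = (\<integral>\<^sup>+y. (\<integral>\<^sup>+x. (\<lambda>z. ennreal (\<bar>fst z + snd z\<bar> powr p)) (x, y) \<partial>distr M borel A) \<partial>distr M borel Y)"
      by simp
    also have "\<dots> = (\<integral>\<^sup>+z. ennreal (\<bar>fst z + snd z\<bar> powr p) \<partial>(distr M borel A \<Otimes>\<^sub>M distr M borel Y))"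
      by (rule nn_integral_snd) measurable
    finally show ?thesis .
  qed
  \<comment> \<open>Independence enters here: the product of the two laws is the joint law.\<close>
  also have "distr M borel A \<Otimes>\<^sub>M distr M borel Y = distr M (borel \<Otimes>\<^sub>M borel) (\<lambda>\<omega>. (A \<omega>, Y \<omega>))"
    using iv unfolding indep_var_distribution_eq by simp
  also have "(\<integral>\<^sup>+z. ennreal (\<bar>fst z + snd z\<bar> powr p) \<partial>distr M (borel \<Otimes>\<^sub>M borel) (\<lambda>\<omega>. (A \<omega>, Y \<omega>)))
    = (\<integral>\<^sup>+\<omega>. ennreal (\<bar>A \<omega> + Y \<omega>\<bar> powr p) \<partial>M)"
    by (subst nn_integral_distr) auto
  also have "\<dots> = (\<integral>\<^sup>+\<omega>. ennreal (\<bar>\<Sum>j\<in>insert i S. a j * U j \<omega>\<bar> powr p) \<partial>M)"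
    using S by (simp add: A_def Y_def)
  finally show ?thesis by (simp add: ennreal_leI)
qed

end
end

subsection \<open>The sharp constant\<close>

text \<open>For t <= 1, Bernoulli's inequality applied to the bound 1 - t^2/n for one factor gives 1
  - t^2, whatever \<open>n\<close> is; for larger t the trivial bound 2 is enough.\<close>

lemma one_minus_sinc_power_le:
  fixes t :: real
  assumes t: "0 < t" and n: "1 \<le> n"
  shows "1 - (sin (t / sqrt (real n)) / (t / sqrt (real n))) ^ n \<le> 2 * min 2 (t\<^sup>2)"
proof -
  let ?x = "t / sqrt (real n)"
  have "\<bar>(sin ?x / ?x) ^ n\<bar> \<le> 1"
    unfolding power_abs by (intro power_le_one abs_ge_zero sinc_le_one)
  then have two: "1 - (sin ?x / ?x) ^ n \<le> 2" by linarith
  show ?thesis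
  proof (cases "t \<le> 1")
    case True
    have x: "0 < ?x" "?x \<le> 1"
      using t n True by (auto simp: field_simps intro: order_trans[of _ 1])
    have xt: "?x\<^sup>2 = t\<^sup>2 / real n" by (simp add: power_divide)
    have "?x\<^sup>2 \<le> 1" using x by (intro power_le_one) auto
    then have "1 + real n * (- ?x\<^sup>2) \<le> (1 + (- ?x\<^sup>2)) ^ n"
      by (intro Bernoulli_inequality) simp
    also have "\<dots> \<le> (sin ?x / ?x) ^ n"
      using sinc_ge[of ?x] x t n \<open>?x\<^sup>2 \<le> 1\<close> by (intro power_mono) auto
    finally have "1 - (sin ?x / ?x) ^ n \<le> t\<^sup>2"
      using n unfolding xt by simp
    moreover have "t\<^sup>2 \<le> 1" using t True by (intro power_le_one) auto
    then have "2 * min 2 (t\<^sup>2) = 2 * t\<^sup>2" by (simp add: min_def)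
    ultimately show ?thesis using zero_le_power2[of t] by linarith
  next
    case False
    then have "1 \<le> t\<^sup>2" by (intro one_le_power) auto
    then show ?thesis using two by (simp add: min_def)
  qed
qed

text \<open>The limit is taken on the Fourier side, where one integrable majorant yields convergence
  of the fractional moments themselves.\<close>

lemma (in prob_space) uniform_sum_moment_tendsto:
  fixes U :: "nat \<Rightarrow> 'a \<Rightarrow> real"
  assumes indep: "indep_vars (\<lambda>_. borel) U {1..}"
    and U: "\<And>j. j \<ge> 1 \<Longrightarrow> distributed M lborel (U j) (\<lambda>x. indicator {-1..1} x / measure lborel {-1..1::real})"
    and p: "0 < p" "p < 1"
  shows "(\<lambda>n. (\<integral>\<^sup>+\<omega>. ennreal (\<bar>\<Sum>j=1..n. 1 / sqrt (real n) * U j \<omega>\<bar> powr p) \<partial>M) * cos_moment p) \<longlonglongrightarrow> gauss_cos_integral p"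
proof -
  define f where "f = (\<lambda>n t. ennreal ((1 - (sin (t / sqrt (real n)) / (t / sqrt (real n))) ^ n) * t powr (- p - 1)) * indicator {0<..} t)"
  define g where "g = (\<lambda>t. ennreal ((1 - exp (- (t\<^sup>2 / 6))) * t powr (- p - 1)) * indicator {0<..} t)"
  define w where "w = (\<lambda>t::real. 2 * (ennreal (min 2 (t\<^sup>2) * t powr (- p - 1)) * indicator {0<..} t))"
  have [measurable]: "f n \<in> borel_measurable lborel" "g \<in> borel_measurable lborel" "w \<in> borel_measurable lborel" for n
    unfolding f_def g_def w_def by measurable
  have eq: "(\<integral>\<^sup>+\<omega>. ennreal (\<bar>\<Sum>j=1..n. 1 / sqrt (real n) * U j \<omega>\<bar> powr p) \<partial>M) * cos_moment p = integral\<^sup>N lborel (f n)"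
    if n: "1 \<le> n" for n
  proof -
    have "(\<integral>\<omega>. cos (t * (\<Sum>j=1..n. 1 / sqrt (real n) * U j \<omega>)) \<partial>M) = (\<Prod>j=1..n. sinc (1 / sqrt (real n) * t))" for t
      using U by (intro expectation_cos_uniform_sum indep_vars_subset[OF indep]) auto
    moreover have "(\<lambda>\<omega>. \<Sum>j=1..n. 1 / sqrt (real n) * U j \<omega>) \<in> borel_measurable M"
      using distributed_measurable[OF U] by (intro borel_measurable_sum borel_measurable_times) auto
    ultimately have "(\<integral>\<^sup>+\<omega>. ennreal (\<bar>\<Sum>j=1..n. 1 / sqrt (real n) * U j \<omega>\<bar> powr p) \<partial>M) * cos_moment p
      = (\<integral>\<^sup>+t\<in>{0<..}. ennreal ((1 - (\<Prod>j=1..n. sinc (1 / sqrt (real n) * t))) * t powr (- p - 1)) \<partial>lborel)"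
      using p by (subst nn_integral_abs_powr_cos) auto
    also have "\<dots> = integral\<^sup>N lborel (f n)"
      unfolding f_def using n by (intro nn_integral_cong) (auto simp: indicator_def)
    finally show ?thesis .
  qed
  \<comment> \<open>The index starts at 1 because \<open>eq\<close> and the majorant are established
    for \<open>1 \<le> n\<close>.\<close>
  have "(\<lambda>n. integral\<^sup>N lborel (f (Suc n))) \<longlonglongrightarrow> integral\<^sup>N lborel g"
  proof (rule nn_integral_dominated_convergence[where w = w])
    show "AE t in lborel. f (Suc n) t \<le> w t" for n
    proof (intro AE_I2)
      fix t :: real
      show "f (Suc n) t \<le> w t"
      proof (cases "0 < t")
        case True
        have "(1 - (sin (t / sqrt (real (Suc n))) / (t / sqrt (real (Suc n)))) ^ Suc n) * t powr (- p - 1)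
          \<le> 2 * min 2 (t\<^sup>2) * t powr (- p - 1)"
          using True by (intro mult_right_mono one_minus_sinc_power_le) auto
        then have "ennreal ((1 - (sin (t / sqrt (real (Suc n))) / (t / sqrt (real (Suc n)))) ^ Suc n) * t powr (- p - 1))
          \<le> ennreal (2 * (min 2 (t\<^sup>2) * t powr (- p - 1)))"
          by (intro ennreal_leI) (simp only: mult.assoc)
        also have "\<dots> = 2 * ennreal (min 2 (t\<^sup>2) * t powr (- p - 1))"
          by (subst ennreal_mult') auto
        finally show ?thesis using True by (simp only: f_def w_def) simp
      qed (simp add: f_def)
    qed
    have "integral\<^sup>N lborel w = 2 * (\<integral>\<^sup>+t\<in>{0<..}. ennreal (min 2 (t\<^sup>2) * t powr (- p - 1)) \<partial>lborel)"
      unfolding w_def by (rule nn_integral_cmult) measurable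
    then show "integral\<^sup>N lborel w < \<infinity>"
      using nn_integral_powr_dominator[OF p] by (simp add: ennreal_mult_less_top)
    show "AE t in lborel. (\<lambda>n. f (Suc n) t) \<longlonglongrightarrow> g t"
    proof (intro AE_I2)
      fix t :: real
      show "(\<lambda>n. f (Suc n) t) \<longlonglongrightarrow> g t"
      proof (cases "0 < t")
        case True
        have "(\<lambda>n. (1 - (sin (t / sqrt (real (Suc n))) / (t / sqrt (real (Suc n)))) ^ Suc n) * t powr (- p - 1))
          \<longlonglongrightarrow> (1 - exp (- (t\<^sup>2 / 6))) * t powr (- p - 1)"
          by (intro tendsto_intros LIMSEQ_Suc[OF tendsto_sinc_power[OF True]])
        then have "(\<lambda>n. ennreal ((1 - (sin (t / sqrt (real (Suc n))) / (t / sqrt (real (Suc n)))) ^ Suc n) * t powr (- p - 1)))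
          \<longlonglongrightarrow> ennreal ((1 - exp (- (t\<^sup>2 / 6))) * t powr (- p - 1))"
          by (rule tendsto_ennrealI)
        then show ?thesis using True by (simp only: f_def g_def) simp
      qed (simp add: f_def g_def)
    qed
  qed measurable
  then have "(\<lambda>n. (\<integral>\<^sup>+\<omega>. ennreal (\<bar>\<Sum>j=1..Suc n. 1 / sqrt (real (Suc n)) * U j \<omega>\<bar> powr p) \<partial>M) * cos_moment p) \<longlonglongrightarrow> gauss_cos_integral p"
    unfolding gauss_cos_integral_def g_def by (subst eq) auto
  then show ?thesis by (rule LIMSEQ_imp_Suc)
qed

lemma (in prob_space) std_normal_abs_powr:
  assumes Z: "distributed M lborel Z std_normal_density" and p: "0 < p"
  shows "(\<integral>\<omega>. \<bar>Z \<omega>\<bar> powr p \<partial>M) = normal_abs_moment p"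
    and "(\<integral>\<^sup>+\<omega>. ennreal (\<bar>Z \<omega> / sqrt 3\<bar> powr p) \<partial>M) = ennreal (3 powr (- p / 2) * normal_abs_moment p)"
proof -
  show eq: "(\<integral>\<omega>. \<bar>Z \<omega>\<bar> powr p \<partial>M) = normal_abs_moment p"
    unfolding normal_abs_moment_def by (rule distributed_integral[OF Z, symmetric]) auto
  have "integrable M (\<lambda>\<omega>. \<bar>Z \<omega>\<bar> powr p)"
    using integrable_normal_abs_powr[OF p] by (subst distributed_integrable[OF Z, symmetric]) auto
  moreover have "\<bar>Z \<omega> / sqrt 3\<bar> powr p = 3 powr (- p / 2) * \<bar>Z \<omega>\<bar> powr p" for \<omega>
  proof -
    have "sqrt 3 powr p = 3 powr (p / 2)" by (simp add: powr_powr flip: powr_half_sqrt)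
    then show ?thesis by (simp add: abs_divide powr_divide powr_minus_divide)
  qed
  ultimately show "(\<integral>\<^sup>+\<omega>. ennreal (\<bar>Z \<omega> / sqrt 3\<bar> powr p) \<partial>M) = ennreal (3 powr (- p / 2) * normal_abs_moment p)"
    by (simp only:) (subst nn_integral_eq_integral, auto simp: eq)
qed

lemma (in prob_space) uniform_sum_moment_ge:
  fixes U :: "nat \<Rightarrow> 'a \<Rightarrow> real"
  assumes indep: "indep_vars (\<lambda>_. borel) U I" and I: "finite I"
    and U: "\<And>j. j \<in> I \<Longrightarrow> distributed M lborel (U j) (\<lambda>x. indicator {-1..1} x / measure lborel {-1..1::real})"
    and a: "(\<Sum>j\<in>I. (a j)\<^sup>2) = 1" and p: "0 < p" "p < 1"
    and gauss: "gauss_cos_integral p = ennreal (3 powr (- p / 2) * normal_abs_moment p) * cos_moment p"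
  shows "ennreal (3 powr (- p / 2) * normal_abs_moment p) \<le> (\<integral>\<^sup>+\<omega>. ennreal (\<bar>\<Sum>j\<in>I. a j * U j \<omega>\<bar> powr p) \<partial>M)"
proof (cases "\<exists>i\<in>I. 25/43 \<le> (a i)\<^sup>2")
  case True
  then obtain i where i: "i \<in> I" "25/43 \<le> (a i)\<^sup>2" by blast
  then have ins: "insert i (I - {i}) = I" by auto
  have "ennreal (3 powr (- p / 2) * normal_abs_moment p)
    \<le> (\<integral>\<^sup>+\<omega>. ennreal (\<bar>\<Sum>j\<in>insert i (I - {i}). a j * U j \<omega>\<bar> powr p) \<partial>M)"
    by (rule uniform_sum_large_coefficient[OF indep U]) (use I a i p in \<open>auto simp: ins insert_absorb\<close>)
  then show ?thesis by (simp only: ins)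
next
  case False
  then have "ennreal (3 powr (- p / 2) * normal_abs_moment p) * cos_moment p
    \<le> (\<integral>\<^sup>+\<omega>. ennreal (\<bar>\<Sum>j\<in>I. a j * U j \<omega>\<bar> powr p) \<partial>M) * cos_moment p"
    unfolding gauss[symmetric]
    by (intro gauss_cos_integral_le_small_coefficients[OF indep I U a _ p(1)]) (auto simp: not_le intro: less_imp_le)
  \<comment> \<open>The factor \<open>cos_moment p\<close> is cancelled, being neither 0 nor
    infinite.\<close>
  then show ?thesis
    using cos_moment_pos[of p] cos_moment_finite[OF p]
    by (subst (asm) (1 2) mult.commute) (simp add: ennreal_mult_le_mult_iff)
qed

theorem theorem1:
  fixes M :: "'a measure" and N :: "'b measure"
    and U :: "nat \<Rightarrow> 'a \<Rightarrow> real" and Z :: "'b \<Rightarrow> real" and p :: real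
  assumes "prob_space M" and "prob_space N"
    and "prob_space.indep_vars M (\<lambda>_. borel) U {1..}"
    and "\<And>j. j \<ge> 1 \<Longrightarrow>
          distributed M lborel (U j) (\<lambda>x. indicator {-1..1} x / measure lborel {-1..1::real})"
    and "distributed N lborel Z std_normal_density"
    and "0 < p" and "p < 1"
  defines "C \<equiv> {c::real. \<forall>n::nat. n \<ge> 1 \<longrightarrow> (\<forall>a :: nat \<Rightarrow> real.
             c * sqrt (\<Sum>j=1..n. (a j)\<^sup>2) \<le> pnorm M p (\<lambda>\<omega>. \<Sum>j=1..n. a j * U j \<omega>))}"
  shows "pnorm N p Z / sqrt 3 \<in> C \<and> (\<forall>c\<in>C. c \<le> pnorm N p Z / sqrt 3)"
proof -
  interpret M: prob_space M by fact
  interpret N: prob_space N by fact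
  note indep = assms(3) and U = assms(4) and Z = assms(5) and p = assms(6,7)
  \<comment> \<open>This is E |Z / sqrt 3|^p, so that m^(1/p) is the claimed constant.\<close>
  define m where "m = 3 powr (- p / 2) * normal_abs_moment p"
  have m0: "0 \<le> m" unfolding m_def normal_abs_moment_def by (intro mult_nonneg_nonneg Bochner_Integration.integral_nonneg) auto
  have gauss: "gauss_cos_integral p = ennreal m * cos_moment p"
    unfolding m_def N.gauss_cos_integral_eq[OF Z p(1), symmetric] N.std_normal_abs_powr(2)[OF Z p(1)] ..
  have mZ: "pnorm N p Z / sqrt 3 = m powr (1 / p)"
  proof -
    have "m powr (1 / p) = 3 powr (- (1 / 2)) * normal_abs_moment p powr (1 / p)"
      unfolding m_def using p by (simp add: powr_mult powr_powr)
    also have "3 powr (- (1 / 2)) = 1 / sqrt (3::real)" by (simp add: powr_minus_divide powr_half_sqrt)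
    finally show ?thesis by (simp add: pnorm_def N.std_normal_abs_powr(1)[OF Z p(1)])
  qed
  define E :: "nat \<Rightarrow> (nat \<Rightarrow> real) \<Rightarrow> real" where "E = (\<lambda>n a. \<integral>\<omega>. \<bar>\<Sum>j=1..n. a j * U j \<omega>\<bar> powr p \<partial>M)"
  have E0: "0 \<le> E n a" for n a unfolding E_def by simp
  have indep_n: "M.indep_vars (\<lambda>_. borel) U {1..n}" for n
    by (rule M.indep_vars_subset[OF indep]) auto
  have U_n: "distributed M lborel (U j) (\<lambda>x. indicator {-1..1} x / measure lborel {-1..1::real})" if "j \<in> {1..n}" for j n
    using U that by simp
  \<comment> \<open>The sums are bounded almost everywhere, so the Bochner integral in
    \<open>pnorm\<close> is the true moment and agrees with the nonnegative integral.\<close>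
  have nnE: "(\<integral>\<^sup>+\<omega>. ennreal (\<bar>\<Sum>j=1..n. a j * U j \<omega>\<bar> powr p) \<partial>M) = ennreal (E n a)" for n a
    unfolding E_def
  proof (rule nn_integral_eq_integral)
    have [measurable]: "(\<lambda>\<omega>. \<Sum>j=1..n. a j * U j \<omega>) \<in> borel_measurable M"
      using M.uniform_sum_measurable[OF indep_n[of n] U_n[of _ n], where S = "{1..n}" and a = a] by auto
    show "integrable M (\<lambda>\<omega>. \<bar>\<Sum>j=1..n. a j * U j \<omega>\<bar> powr p)"
    proof (rule M.integrable_const_bound)
      have "AE \<omega> in M. \<bar>\<Sum>j=1..n. a j * U j \<omega>\<bar> \<le> (\<Sum>j=1..n. \<bar>a j\<bar>)"
        using M.uniform_sum_bounded[OF indep_n[of n] U_n[of _ n], where S = "{1..n}" and a = a] by auto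
      then show "AE \<omega> in M. norm (\<bar>\<Sum>j=1..n. a j * U j \<omega>\<bar> powr p) \<le> (\<Sum>j=1..n. \<bar>a j\<bar>) powr p"
        by eventually_elim (use p in \<open>auto intro!: powr_mono2\<close>)
    qed measurable
  qed auto
  have lower: "m \<le> E n a" if "(\<Sum>j=1..n. (a j)\<^sup>2) = 1" for n a
    using M.uniform_sum_moment_ge[OF indep_n[of n] _ U_n[of _ n] that p gauss[unfolded m_def]] E0
    unfolding nnE m_def[symmetric] by (simp add: ennreal_le_iff)
  have pn: "pnorm M p (\<lambda>\<omega>. \<Sum>j=1..n. a j * U j \<omega>) = E n a powr (1 / p)" for n a
    by (simp add: pnorm_def E_def)
  have "pnorm N p Z / sqrt 3 \<in> C"
    unfolding C_def mem_Collect_eq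
  proof (intro allI impI)
    fix n :: nat and a :: "nat \<Rightarrow> real"
    define V where "V = (\<Sum>j=1..n. (a j)\<^sup>2)"
    have "0 \<le> V" by (simp add: V_def sum_nonneg)
    show "pnorm N p Z / sqrt 3 * sqrt (\<Sum>j=1..n. (a j)\<^sup>2) \<le> pnorm M p (\<lambda>\<omega>. \<Sum>j=1..n. a j * U j \<omega>)"
    proof (cases "V = 0")
      case False
      then have V: "0 < V" using \<open>0 \<le> V\<close> by simp
      have sV: "(sqrt V powr p) powr (1 / p) = sqrt V"
      proof -
        have "(sqrt V powr p) powr (1 / p) = sqrt V powr (p * (1 / p))" by (rule powr_powr)
        then show ?thesis using V p by simp
      qed
      have "(\<Sum>j=1..n. (a j / sqrt V)\<^sup>2) = V / V"
        using V unfolding V_def[symmetric] sum_divide_distrib[symmetric] by (simp add: power_divide V_def flip: sum_divide_distrib)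
      then have "m \<le> E n (\<lambda>j. a j / sqrt V)" using V by (intro lower) simp
      moreover have "E n a = sqrt V powr p * E n (\<lambda>j. a j / sqrt V)"
      proof -
        have "\<bar>\<Sum>j=1..n. a j * U j \<omega>\<bar> powr p = sqrt V powr p * \<bar>\<Sum>j=1..n. a j / sqrt V * U j \<omega>\<bar> powr p" for \<omega>
        proof -
          have "(\<Sum>j=1..n. a j * U j \<omega>) = sqrt V * (\<Sum>j=1..n. a j / sqrt V * U j \<omega>)"
            using V by (simp add: sum_distrib_left)
          then show ?thesis using V by (simp add: abs_mult powr_mult)
        qed
        then show ?thesis by (simp add: E_def)
      qed
      ultimately have "(sqrt V powr p * m) powr (1 / p) \<le> E n a powr (1 / p)"
        using p m0 by (intro powr_mono2) (auto intro!: mult_left_mono)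
      then show ?thesis
        unfolding pn mZ V_def[symmetric] by (simp add: powr_mult sV mult.commute)
    next
      case True
      then show ?thesis unfolding V_def[symmetric] pn by simp
    qed
  qed
  moreover have "c \<le> pnorm N p Z / sqrt 3" if c: "c \<in> C" for c
  proof -
    define k where "k = enn2real (cos_moment p)"
    have k: "0 < k" "cos_moment p = ennreal k"
      using cos_moment_pos[of p] cos_moment_finite[OF p] by (auto simp: k_def enn2real_positive_iff)
    \<comment> \<open>Equal coefficients 1 / sqrt n form unit vectors, so every \<open>c\<close> in
      \<open>C\<close> is at most e_n^(1/p) for n >= 1, and hence at most the limit.\<close>
    define e where "e = (\<lambda>n. E n (\<lambda>_. 1 / sqrt (real n)))"
    have "(\<lambda>n. ennreal (e n * k)) \<longlonglongrightarrow> ennreal (m * k)"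
      using M.uniform_sum_moment_tendsto[OF indep U p] k E0 m0
      unfolding nnE gauss by (simp add: e_def ennreal_mult)
    then have "(\<lambda>n. e n * k) \<longlonglongrightarrow> m * k"
      by (rule tendsto_ennrealD) (use k m0 E0 in \<open>auto simp: e_def\<close>)
    from tendsto_divide[OF this tendsto_const[of k]] k have "e \<longlonglongrightarrow> m" by simp
    then have "(\<lambda>n. e n powr (1 / p)) \<longlonglongrightarrow> m powr (1 / p)"
      using p E0 by (intro tendsto_powr' tendsto_const) (auto simp: e_def)
    moreover have "\<forall>\<^sub>F n in sequentially. c \<le> e n powr (1 / p)"
    proof (rule eventually_sequentiallyI[of 1])
      fix n :: nat assume n: "1 \<le> n"
      have "(\<Sum>j=1..n. (1 / sqrt (real n))\<^sup>2) = 1" using n by (simp add: power_divide)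
      moreover have "c * sqrt (\<Sum>j=1..n. (1 / sqrt (real n))\<^sup>2) \<le> pnorm M p (\<lambda>\<omega>. \<Sum>j=1..n. 1 / sqrt (real n) * U j \<omega>)"
      proof -
        from c have "\<forall>n::nat. n \<ge> 1 \<longrightarrow> (\<forall>a :: nat \<Rightarrow> real.
            c * sqrt (\<Sum>j=1..n. (a j)\<^sup>2) \<le> pnorm M p (\<lambda>\<omega>. \<Sum>j=1..n. a j * U j \<omega>))"
          unfolding C_def by (rule CollectD)
        from this[rule_format, OF n, of "\<lambda>_. 1 / sqrt (real n)"] show ?thesis .
      qed
      ultimately have "c * sqrt 1 \<le> pnorm M p (\<lambda>\<omega>. \<Sum>j=1..n. 1 / sqrt (real n) * U j \<omega>)"
        by (simp only:)
      also have "\<dots> = e n powr (1 / p)"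
        unfolding e_def by (rule pn)
      finally show "c \<le> e n powr (1 / p)" by simp
    qed
    ultimately have "c \<le> m powr (1 / p)" by (rule tendsto_lowerbound) simp
    then show ?thesis unfolding mZ .
  qed
  ultimately show ?thesis by blast
qed

end
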